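(* Let $A$ be a countably infinite set and $f:A\to A$ a bijection. Then there exist an integer $n\ge1$ and a binary operation $*$ on $A$ such that $(A,* )$ is a group isomorphic to $(\mathbb{Z}^n,+)$ and $f$ is an automorphism of $(A,* )$ if and only if all of the following hold: (1) $f$ has at least one cycle of length $1$ (a fixed point); fix one such fixed point $a_0$ (playing the role of the zero cycle), and call the cycles of $f$ other than $\{a_0\}$ non-zero cycles; (2) the set of distinct lengths of cycles of $f$ is finite; (3) if $f$ has a non-zero cycle of length $k$, then $f$ has infinitely many cycles of length $k$; (4) if $f$ has a chain, then $f$ has infinitely many chains; (5) if $f$ has non-zero cycles of lengths $\alpha$ and $\beta$, then $f$ has a cycle of length $\mathrm{lcm}(\alpha,\beta)$.
   Context: For a bijection $f$ of a set $A$, a cycle is a finite sequence $a_1,\dots,a_m$ of distinct elements with $f(a_j)=a_{j+1}$ for $j<m$ and $f(a_m)=a_1$ (of length $m$); a chain is a two-sided infinite sequence $\dots,a_{-1},a_0,a_1,\dots$ of distinct elements with $f(a_j)=a_{j+1}$ for all $j$. Every element of $A$ lies in exactly one cycle or chain. In the paper, "non-zero cycle" refers to cycles other than the one that would correspond to the identity element; here this is expressed via the chosen fixed point $a_0$. *)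

theory Defs
  imports "HOL-Algebra.Group" "HOL-Library.Countable_Set"
begin

definition Zn_group :: "nat \<Rightarrow> (nat \<Rightarrow> int) monoid" where
  "Zn_group n = \<lparr>carrier = {v. \<forall>i\<ge>n. v i = 0},
                  mult = (\<lambda>u v i. u i + v i),
                  one = (\<lambda>_. 0)\<rparr>"

definition on_cycle_len :: "('a \<Rightarrow> 'a) \<Rightarrow> 'a \<Rightarrow> nat \<Rightarrow> bool" where
  "on_cycle_len f a m \<longleftrightarrow> 0 < m \<and> (f ^^ m) a = a \<and> (\<forall>k. 0 < k \<and> k < m \<longrightarrow> (f ^^ k) a \<noteq> a)"

definition on_chain :: "('a \<Rightarrow> 'a) \<Rightarrow> 'a \<Rightarrow> bool" where
  "on_chain f a \<longleftrightarrow> (\<forall>k>0. (f ^^ k) a \<noteq> a)"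

definition cycles_of_len :: "('a \<Rightarrow> 'a) \<Rightarrow> 'a set \<Rightarrow> nat \<Rightarrow> 'a set set" where
  "cycles_of_len f A m = {{(f ^^ k) a | k. True} | a. a \<in> A \<and> on_cycle_len f a m}"

definition chains_of :: "('a \<Rightarrow> 'a) \<Rightarrow> 'a set \<Rightarrow> 'a set set" where
  "chains_of f A = {{(f ^^ k) a | k. True} \<union> {(inv_into A f ^^ k) a | k. True} | a. a \<in> A \<and> on_chain f a}"

end

theory Submission
  imports Defs "HOL-Library.Function_Algebras" "HOL-Number_Theory.Cong" "HOL-Computational_Algebra.Primes"
begin

text \<open>Two bijections of countable sets are conjugate as soon as they have equally many orbits of each
  length, so only the possible orbit statistics of automorphisms \<open>g\<close> of \<open>\<int>\<^sup>n\<close> matter.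

  Necessity: the multiples \<open>2 ^ a v\<close> of a nonzero vector have the same period and lie in distinct
  orbits; among the vectors \<open>u + k v\<close> one has period \<open>lcm\<close> of the periods of \<open>u\<close> and \<open>v\<close>, by
  pigeonhole on the divisors of this number; and a finite set of periodic vectors that spans all
  of them up to saturation bounds the periods.

  Sufficiency: for every length \<open>k\<close> there is a finite-rank lattice of integer sequences on which the
  shift gives every nonzero sequence period exactly \<open>k\<close> (infinite for chains). In the direct sum
  over the required lengths the period of a vector is the \<open>lcm\<close> of those of its nonzero components.\<close>

section \<open>Periods and orbits\<close>

text \<open>Only the set of periods of nonzero points has to be matched: conditions (3) and (4) for
  \<open>f\<close>, and \<open>infinite_orbits\<close> for the lattice, make every such period occur
  on infinitely many orbits. The sequence lattices play the part of the cyclotomic rings. Over the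
  rationals, the conditions of \<open>seqs k\<close> for k > 0 say that the k-th cyclotomic
  polynomial of the shift annihilates the sequence. For k = 0 the polynomial is t^2 - 3 t + 1, the
  characteristic polynomial of the cat map with rows (2, 1) and (1, 1), whose roots are real and
  different from 1 and -1. With sequences in place of matrices, invertibility means running a
  recurrence backwards, and freeness follows from the fact that finitely many coordinates determine
  a vector.\<close>

text \<open>The period is \<open>0\<close> for points on a chain, so that cycles and chains are treated alike.\<close>

definition has_period :: "('a \<Rightarrow> 'a) \<Rightarrow> 'a \<Rightarrow> nat \<Rightarrow> bool" where
  "has_period f a t \<longleftrightarrow> (\<forall>m. (f ^^ m) a = a \<longleftrightarrow> t dvd m)"

text \<open>Requiring forward iterates to meet replaces integer powers of \<open>f\<close>: for
  injective \<open>f\<close> it describes finite cycles and two-sided chains alike, without an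
  inverse.\<close>

definition orbit :: "('a \<Rightarrow> 'a) \<Rightarrow> 'a set \<Rightarrow> 'a \<Rightarrow> 'a set" where
  "orbit f A a = {b \<in> A. \<exists>m n. (f ^^ m) a = (f ^^ n) b}"

definition orbits :: "('a \<Rightarrow> 'a) \<Rightarrow> 'a set \<Rightarrow> nat \<Rightarrow> 'a set set" where
  "orbits f A t = orbit f A ` {a \<in> A. has_period f a t}"

lemma on_cycle_len_iff: "on_cycle_len f a m \<longleftrightarrow> 0 < m \<and> has_period f a m"
proof
  assume *: "on_cycle_len f a m"
  have "(f ^^ k) a = a \<longleftrightarrow> m dvd k" for k
  proof -
    have "(f ^^ k) a = (f ^^ (k mod m)) a"
      using * by (simp add: on_cycle_len_def funpow_mod_eq)
    moreover have "k mod m < m" using * by (simp add: on_cycle_len_def)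
    ultimately show ?thesis
      using * by (auto simp: on_cycle_len_def dvd_eq_mod_eq_0)
  qed
  then show "0 < m \<and> has_period f a m" using * by (simp add: has_period_def on_cycle_len_def)
next
  assume "0 < m \<and> has_period f a m"
  then show "on_cycle_len f a m"
    by (auto simp: has_period_def on_cycle_len_def dest: nat_dvd_not_less)
qed

lemma on_chain_iff: "on_chain f a \<longleftrightarrow> has_period f a 0"
proof -
  have "(\<forall>k>0. (f ^^ k) a \<noteq> a) \<longleftrightarrow> (\<forall>m. (f ^^ m) a = a \<longleftrightarrow> m = 0)"
    by (metis funpow_0 neq0_conv)
  then show ?thesis by (simp add: on_chain_def has_period_def)
qed

lemma has_period_unique: "has_period f a s \<Longrightarrow> has_period f a t \<Longrightarrow> s = t"
  unfolding has_period_def by (meson dvd_antisym dvd_refl)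

lemma has_period_exists: "\<exists>t. has_period f a t"
proof (cases "on_chain f a")
  case True
  then show ?thesis unfolding on_chain_iff by (rule exI)
next
  case False
  then obtain k where k: "k > 0 \<and> (f ^^ k) a = a" unfolding on_chain_def by blast
  define m where "m = (LEAST k. k > 0 \<and> (f ^^ k) a = a)"
  have "m > 0 \<and> (f ^^ m) a = a" unfolding m_def by (rule LeastI[of _ k]) (rule k)
  moreover have "\<not> (j > 0 \<and> (f ^^ j) a = a)" if "j < m" for j
    using not_less_Least that unfolding m_def by blast
  ultimately have "on_cycle_len f a m" by (auto simp: on_cycle_len_def)
  then have "has_period f a m" by (simp add: on_cycle_len_iff)
  then show ?thesis by (rule exI)
qed

lemma funpow_mem:
  assumes "bij_betw f A A" "a \<in> A" shows "(f ^^ m) a \<in> A"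
  using bij_betw_funpow[OF assms(1), of m] assms(2) by (rule bij_betwE[THEN bspec])

lemma funpow_inj:
  assumes "bij_betw f A A" "a \<in> A" "b \<in> A" "(f ^^ m) a = (f ^^ m) b" shows "a = b"
  using bij_betw_funpow[OF assms(1), of m] assms(2-4) by (auto simp: bij_betw_def inj_on_def)

lemma funpow_surj:
  assumes "bij_betw f A A" "b \<in> A" obtains a where "a \<in> A" "(f ^^ m) a = b"
  using bij_betw_funpow[OF assms(1), of m] assms(2) unfolding bij_betw_def by (metis imageE)

lemma funpow_comm: "(f ^^ m) ((f ^^ n) a) = (f ^^ n) ((f ^^ m) a)"
  by (metis add.commute comp_apply funpow_add)

lemma funpow_plus: "(f ^^ (m + n)) a = (f ^^ m) ((f ^^ n) a)"
  by (simp add: funpow_add)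

lemma orbit_self: "a \<in> A \<Longrightarrow> a \<in> orbit f A a"
  by (auto simp: orbit_def)

lemma orbit_eqI:
  assumes bij: "bij_betw f A A" and a: "a \<in> A" and b: "b \<in> orbit f A a"
  shows "orbit f A b = orbit f A a"
proof -
  obtain m n where mn: "(f ^^ m) a = (f ^^ n) b" and bA: "b \<in> A"
    using b by (auto simp: orbit_def)
  have *: "\<exists>i j. (f ^^ i) y = (f ^^ j) c"
    if "(f ^^ p) x = (f ^^ q) c" "(f ^^ r) x = (f ^^ s) y" for c x y p q r s
  proof -
    have "(f ^^ (p + s)) y = (f ^^ p) ((f ^^ r) x)" using that(2) by (simp add: funpow_plus)
    also have "\<dots> = (f ^^ (r + q)) c" using that(1) by (simp add: funpow_plus funpow_comm[of p])
    finally show ?thesis by blast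
  qed
  show ?thesis unfolding orbit_def using mn * by blast
qed

lemma orbit_eq_iff:
  assumes "bij_betw f A A" "a \<in> A" "b \<in> A"
  shows "orbit f A b = orbit f A a \<longleftrightarrow> (\<exists>m n. (f ^^ m) a = (f ^^ n) b)"
proof
  assume "orbit f A b = orbit f A a"
  then have "b \<in> orbit f A a" using orbit_self assms(3) by metis
  then show "\<exists>m n. (f ^^ m) a = (f ^^ n) b" by (simp add: orbit_def)
next
  assume "\<exists>m n. (f ^^ m) a = (f ^^ n) b"
  then have "b \<in> orbit f A a" using assms(3) by (simp add: orbit_def)
  then show "orbit f A b = orbit f A a" using orbit_eqI assms by metis
qed

lemma has_period_funpow:
  assumes "bij_betw f A A" "a \<in> A"
  shows "has_period f ((f ^^ m) a) t \<longleftrightarrow> has_period f a t"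
proof -
  have "(f ^^ k) ((f ^^ m) a) = (f ^^ m) a \<longleftrightarrow> (f ^^ k) a = a" for k
    using funpow_inj[OF assms(1) _ assms(2)] funpow_mem[OF assms] by (metis funpow_comm)
  then show ?thesis by (simp add: has_period_def)
qed

lemma has_period_orbit:
  assumes "bij_betw f A A" "a \<in> A" "b \<in> orbit f A a"
  shows "has_period f b t \<longleftrightarrow> has_period f a t"
proof -
  obtain m n where "(f ^^ m) a = (f ^^ n) b" and "b \<in> A"
    using assms(3) by (auto simp: orbit_def)
  then show ?thesis
    using has_period_funpow[OF assms(1)] assms(2) by metis
qed

text \<open>Congruence modulo 0 is equality, so chains are covered as well.\<close>

lemma funpow_eq_iff_cong:
  assumes "bij_betw f A A" "a \<in> A" "has_period f a t"
  shows "(f ^^ i) a = (f ^^ j) a \<longleftrightarrow> [i = j] (mod t)"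
proof -
  have *: "(f ^^ i) a = (f ^^ j) a \<longleftrightarrow> [i = j] (mod t)" if "i \<le> j" for i j
  proof -
    have "(f ^^ j) a = (f ^^ i) ((f ^^ (j - i)) a)"
      using that by (metis funpow_plus le_add_diff_inverse)
    then have "(f ^^ i) a = (f ^^ j) a \<longleftrightarrow> (f ^^ (j - i)) a = a"
      using funpow_inj[OF assms(1) _ assms(2)] funpow_mem[OF assms(1,2)] by metis
    also have "\<dots> \<longleftrightarrow> t dvd (j - i)" using assms(3) by (simp add: has_period_def)
    also have "\<dots> \<longleftrightarrow> [i = j] (mod t)"
      using that by (metis cong_altdef_nat cong_sym_eq)
    finally show ?thesis .
  qed
  show ?thesis
    by (cases "i \<le> j") (use *[of i j] *[of j i] in \<open>auto simp: cong_sym_eq eq_commute\<close>)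
qed

section \<open>Cycles and chains as orbits\<close>

lemma cycles_of_len_eq_orbits:
  assumes bij: "bij_betw f A A" and "t > 0"
  shows "cycles_of_len f A t = orbits f A t"
proof -
  have "{(f ^^ k) a | k. True} = orbit f A a" if a: "a \<in> A" and p: "has_period f a t" for a
  proof (intro equalityI subsetI)
    fix b assume "b \<in> {(f ^^ k) a | k. True}"
    then obtain k where "b = (f ^^ k) a" by blast
    then show "b \<in> orbit f A a"
      using funpow_mem[OF bij a] unfolding orbit_def by (metis (mono_tags, lifting) funpow_0 mem_Collect_eq)
  next
    fix b assume "b \<in> orbit f A a"
    then obtain m n where mn: "(f ^^ m) a = (f ^^ n) b" and b: "b \<in> A" by (auto simp: orbit_def)
    \<comment> \<open>On a cycle, going back \<open>n\<close> steps amounts to going forward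
      \<open>n * t - n\<close> steps.\<close>
    have le: "n \<le> n * t" using \<open>t > 0\<close> by simp
    have "has_period f b t" using has_period_orbit[OF bij a \<open>b \<in> orbit f A a\<close>] p by simp
    then have "b = (f ^^ (n * t)) b" unfolding has_period_def by (metis dvd_triv_right)
    also have "\<dots> = (f ^^ (n * t - n)) ((f ^^ n) b)"
      using le by (metis funpow_plus le_add_diff_inverse2)
    also have "\<dots> = (f ^^ (n * t - n + m)) a" by (simp add: mn[symmetric] funpow_plus)
    finally show "b \<in> {(f ^^ k) a | k. True}" by blast
  qed
  then show ?thesis using \<open>t > 0\<close> unfolding cycles_of_len_def orbits_def on_cycle_len_iff by auto
qed

lemma cycles_of_len_0: "cycles_of_len f A 0 = {}"
  by (auto simp: cycles_of_len_def on_cycle_len_def)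

lemma chains_of_eq_orbits:
  assumes bij: "bij_betw f A A"
  shows "chains_of f A = orbits f A 0"
proof -
  let ?g = "inv_into A f"
  have bg: "bij_betw ?g A A" by (rule bij_betw_inv_into[OF bij])
  have fg: "(f ^^ k) ((?g ^^ k) b) = b" if "b \<in> A" for b k
    using that
  proof (induction k arbitrary: b)
    case (Suc k)
    have "(f ^^ Suc k) ((?g ^^ Suc k) b) = f ((f ^^ k) ((?g ^^ k) (?g b)))"
      by (simp add: funpow_swap1)
    also have "\<dots> = f (?g b)" using Suc bg by (simp add: bij_betwE)
    also have "\<dots> = b" using bij Suc.prems by (simp add: bij_betw_inv_into_right)
    finally show ?case .
  qed simp
  have "{(f ^^ k) a | k. True} \<union> {(?g ^^ k) a | k. True} = orbit f A a" if a: "a \<in> A" for a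
  proof (intro equalityI subsetI)
    fix b assume "b \<in> {(f ^^ k) a | k. True} \<union> {(?g ^^ k) a | k. True}"
    then obtain k where "b = (f ^^ k) a \<or> b = (?g ^^ k) a" by blast
    then show "b \<in> orbit f A a"
    proof
      assume "b = (f ^^ k) a"
      then show ?thesis using funpow_mem[OF bij a] unfolding orbit_def
        by (metis (mono_tags, lifting) funpow_0 mem_Collect_eq)
    next
      assume "b = (?g ^^ k) a"
      then show ?thesis using funpow_mem[OF bg a] fg[OF a] unfolding orbit_def
        by (metis (mono_tags, lifting) funpow_0 mem_Collect_eq)
    qed
  next
    fix b assume "b \<in> orbit f A a"
    then obtain m n where mn: "(f ^^ m) a = (f ^^ n) b" and b: "b \<in> A" by (auto simp: orbit_def)
    show "b \<in> {(f ^^ k) a | k. True} \<union> {(?g ^^ k) a | k. True}"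
    proof (cases "n \<le> m")
      case True
      then have "(f ^^ n) b = (f ^^ n) ((f ^^ (m - n)) a)"
        using mn by (metis funpow_plus le_add_diff_inverse)
      then have "b = (f ^^ (m - n)) a" using funpow_inj[OF bij b funpow_mem[OF bij a]] by blast
      then show ?thesis by blast
    next
      case False
      then have "(f ^^ m) a = (f ^^ m) ((f ^^ (n - m)) b)"
        using mn by (metis funpow_plus le_add_diff_inverse nat_le_linear)
      then have "a = (f ^^ (n - m)) b" using funpow_inj[OF bij a funpow_mem[OF bij b]] by blast
      then have "(f ^^ (n - m)) b = (f ^^ (n - m)) ((?g ^^ (n - m)) a)" using fg[OF a] by metis
      then have "b = (?g ^^ (n - m)) a"
        using funpow_inj[OF bij b funpow_mem[OF bg a]] by blast
      then show ?thesis by blast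
    qed
  qed
  then show ?thesis unfolding chains_of_def orbits_def on_chain_iff image_def by (auto; metis)
qed

section \<open>Conjugate bijections\<close>

text \<open>Choose a base point in each orbit of \<open>f\<close> and one in the matched orbit of
  \<open>g\<close>; \<open>h\<close> carries the i-th iterate of the first to the i-th iterate of
  the second, for all integers i. As the periods agree, well-definedness and injectivity come from
  one and the same congruence.\<close>

lemma conjugation_exists:
  assumes f: "bij_betw f A A" and g: "bij_betw g B B"
    and equinumerous: "\<And>t. \<exists>\<sigma>. bij_betw \<sigma> (orbits f A t) (orbits g B t)"
  obtains h where "bij_betw h A B" "\<And>a. a \<in> A \<Longrightarrow> h (f a) = g (h a)"
proof -
  obtain \<sigma> where \<sigma>: "\<And>t. bij_betw (\<sigma> t) (orbits f A t) (orbits g B t)"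
    using equinumerous by metis
  define t where "t a = (THE t. has_period f a t)" for a
  have t_eq: "t a = u" if "has_period f a u" for a u
    unfolding t_def using that by (rule the_equality) (rule has_period_unique[OF _ that])
  have t: "has_period f a (t a)" for a
    using has_period_exists[of f a] t_eq by metis
  \<comment> \<open>The choices depend on \<open>a\<close> only through its orbit and period, so all
    points of an orbit share the base points \<open>r a\<close> and \<open>s a\<close>.\<close>
  define r where "r a = (SOME x. x \<in> orbit f A a)" for a
  define s where "s a = (SOME y. y \<in> \<sigma> (t a) (orbit f A a))" for a
  have r: "r a \<in> orbit f A a" if "a \<in> A" for a
    unfolding r_def using orbit_self[OF that] by (rule someI)
  have orbits: "orbit f A a \<in> orbits f A (t a)" if "a \<in> A" for a
    using that t by (auto simp: orbits_def)
  have s: "s a \<in> B \<and> has_period g (s a) (t a) \<and> \<sigma> (t a) (orbit f A a) = orbit g B (s a)"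
    if a: "a \<in> A" for a
  proof -
    have "\<sigma> (t a) (orbit f A a) \<in> orbits g B (t a)"
      using \<sigma> orbits[OF a] by (rule bij_betwE[THEN bspec])
    then obtain y where y: "y \<in> B" "has_period g y (t a)" "\<sigma> (t a) (orbit f A a) = orbit g B y"
      by (auto simp: orbits_def)
    have "s a \<in> orbit g B y"
      unfolding s_def y(3) using orbit_self[OF y(1)] by (rule someI)
    then show ?thesis
      using y orbit_eqI[OF g] has_period_orbit[OF g] by (simp add: orbit_def)
  qed
  have same_orbit: "r b = r a \<and> s b = s a \<and> t b = t a" if a: "a \<in> A" and b: "b \<in> orbit f A a" for a b
  proof -
    have "orbit f A b = orbit f A a" by (rule orbit_eqI[OF f a b])
    moreover have "t b = t a" using has_period_orbit[OF f a b] t t_eq by simp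
    ultimately show ?thesis by (simp add: r_def s_def)
  qed
  have sync: "(f ^^ i) (r a) = (f ^^ j) (r a) \<longleftrightarrow> (g ^^ i) (s a) = (g ^^ j) (s a)"
    if a: "a \<in> A" for a i j
  proof -
    have "r a \<in> A" "has_period f (r a) (t a)"
      using r[OF a] t has_period_orbit[OF f a] by (auto simp: orbit_def)
    then show ?thesis using funpow_eq_iff_cong[OF f] funpow_eq_iff_cong[OF g] s[OF a] by metis
  qed
  \<comment> \<open>The pair (m, n) encodes the integer power n - m applied to both base
    points.\<close>
  define R where "R a b \<longleftrightarrow> b \<in> B \<and> (\<exists>m n. (f ^^ m) a = (f ^^ n) (r a) \<and> (g ^^ m) b = (g ^^ n) (s a))" for a b
  \<comment> \<open>Adding the same amount to both exponents brings two encodings to a common left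
    exponent.\<close>
  have cross: "(F ^^ (m + m')) x = (F ^^ (n + m')) z"
    if "(F ^^ m) x = (F ^^ n) z" for F :: "'c \<Rightarrow> 'c" and m m' n x z
    using that by (metis add.commute funpow_plus)
  have ex: "\<exists>b. R a b" if a: "a \<in> A" for a
  proof -
    obtain m n where "(f ^^ m) a = (f ^^ n) (r a)" using r[OF a] by (auto simp: orbit_def)
    moreover obtain b where "b \<in> B" "(g ^^ m) b = (g ^^ n) (s a)"
      using funpow_surj[OF g funpow_mem[OF g]] s[OF a] by metis
    ultimately show ?thesis unfolding R_def by blast
  qed
  have uniq: "b = b'" if a: "a \<in> A" and R: "R a b" "R a b'" for a b b'
  proof -
    obtain m n m' n' where 1: "(f ^^ m) a = (f ^^ n) (r a)" "(g ^^ m) b = (g ^^ n) (s a)"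
      and 2: "(f ^^ m') a = (f ^^ n') (r a)" "(g ^^ m') b' = (g ^^ n') (s a)"
      using R unfolding R_def by blast
    have "(f ^^ (n + m')) (r a) = (f ^^ (n' + m)) (r a)"
      using cross[OF 1(1), of m'] cross[OF 2(1), of m] by (simp add: add.commute)
    then have "(g ^^ (m + m')) b = (g ^^ (m' + m)) b'"
      using cross[OF 1(2), of m'] cross[OF 2(2), of m] sync[OF a] by simp
    then show ?thesis using funpow_inj[OF g] R unfolding R_def by (metis add.commute)
  qed
  have inj: "a = a'" if a: "a \<in> A" and a': "a' \<in> A" and R: "R a b" "R a' b" for a a' b
  proof -
    obtain m n m' n' where 1: "(f ^^ m) a = (f ^^ n) (r a)" "(g ^^ m) b = (g ^^ n) (s a)"
      and 2: "(f ^^ m') a' = (f ^^ n') (r a')" "(g ^^ m') b = (g ^^ n') (s a')" and b: "b \<in> B"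
      using R unfolding R_def by blast
    have o: "orbit g B (s a) = orbit g B (s a')"
      using orbit_eq_iff[OF g b] s[OF a] s[OF a'] 1(2) 2(2) by metis
    then have "s a \<in> orbit g B (s a')" using orbit_self s[OF a] by metis
    then have "has_period g (s a) (t a')" using has_period_orbit[OF g] s[OF a'] by metis
    \<comment> \<open>The matching \<sigma> is injective for each period separately, so the periods
      must be equal before it can identify the orbits.\<close>
    then have tt: "t a = t a'" using s[OF a] has_period_unique by metis
    have "orbit f A a = orbit f A a'"
      using o s[OF a] s[OF a'] orbits[OF a] orbits[OF a'] \<sigma>[of "t a"] unfolding tt
      by (metis bij_betw_def inj_onD)
    then have "a' \<in> orbit f A a" using orbit_self[OF a'] by simp
    then have same: "r a' = r a" "s a' = s a" using same_orbit[OF a] by simp_all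
    have "(g ^^ (n + m')) (s a) = (g ^^ (n' + m)) (s a)"
      using cross[OF 1(2), of m'] cross[OF 2(2), of m] same by (simp add: add.commute)
    then have "(f ^^ (m + m')) a = (f ^^ (m' + m)) a'"
      using cross[OF 1(1), of m'] cross[OF 2(1), of m] sync[OF a] same by simp
    then show ?thesis using funpow_inj[OF f a a'] by (metis add.commute)
  qed
  have surj: "\<exists>a\<in>A. R a b" if b: "b \<in> B" for b
  proof -
    obtain u where u: "has_period g b u" using has_period_exists[of g b] by blast
    then have "orbit g B b \<in> orbits g B u" using b by (auto simp: orbits_def)
    then obtain a0 where a0: "a0 \<in> A" "has_period f a0 u" "orbit g B b = \<sigma> u (orbit f A a0)"
      using \<sigma>[of u] unfolding bij_betw_def orbits_def by (smt (verit) imageE mem_Collect_eq)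
    have "orbit g B b = orbit g B (s a0)" using a0 s t_eq by metis
    then obtain m n where mn: "(g ^^ m) b = (g ^^ n) (s a0)"
      using orbit_eq_iff[OF g b] s[OF a0(1)] by metis
    have rA: "r a0 \<in> A" using r[OF a0(1)] by (simp add: orbit_def)
    obtain a where a: "a \<in> A" "(f ^^ m) a = (f ^^ n) (r a0)"
      using funpow_surj[OF f funpow_mem[OF f rA]] by metis
    have "orbit f A a = orbit f A a0"
      using orbit_eq_iff[OF f a(1) rA] a(2) orbit_eqI[OF f a0(1) r[OF a0(1)]] by metis
    then have "a \<in> orbit f A a0" using orbit_self[OF a(1)] by metis
    then have "R a b" using same_orbit[OF a0(1)] a(2) mn b unfolding R_def by metis
    then show ?thesis using a(1) by blast
  qed
  define h where "h a = (SOME b. R a b)" for a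
  have h: "R a (h a)" if "a \<in> A" for a
    unfolding h_def using ex[OF that] by (rule someI_ex)
  have "bij_betw h A B"
  proof (rule bij_betw_imageI)
    show "inj_on h A" using h inj by (metis inj_onI)
    show "h ` A = B"
    proof (intro equalityI subsetI)
      fix b assume "b \<in> h ` A" then show "b \<in> B" using h R_def by auto
    next
      fix b assume "b \<in> B"
      then obtain a where "a \<in> A" "R a b" using surj by blast
      then show "b \<in> h ` A" using uniq h by blast
    qed
  qed
  moreover have "h (f a) = g (h a)" if a: "a \<in> A" for a
  proof -
    have fa: "f a \<in> A" using f a by (simp add: bij_betwE)
    have "(f ^^ 1) a = (f ^^ 0) (f a)" by simp
    then have "f a \<in> orbit f A a" using fa unfolding orbit_def by blast
    then have same: "r (f a) = r a" "s (f a) = s a" using same_orbit[OF a] by simp_all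
    obtain m n where "h a \<in> B" "(f ^^ m) a = (f ^^ n) (r a)" "(g ^^ m) (h a) = (g ^^ n) (s a)"
      using h[OF a] unfolding R_def by blast
    then have "g (h a) \<in> B \<and> (f ^^ m) (f a) = (f ^^ Suc n) (r (f a)) \<and> (g ^^ m) (g (h a)) = (g ^^ Suc n) (s (f a))"
      using g by (simp add: same funpow_swap1[symmetric] bij_betwE)
    then have "R (f a) (g (h a))" unfolding R_def by blast
    then show ?thesis using uniq fa h by blast
  qed
  ultimately show ?thesis using that by blast
qed

section \<open>Transport of periods and orbits along a conjugation\<close>

lemma conjugate_funpow:
  assumes "bij_betw f A A" "\<forall>a\<in>A. h (f a) = g (h a)" "a \<in> A"
  shows "h ((f ^^ m) a) = (g ^^ m) (h a)"
  using funpow_mem[OF assms(1,3)] assms(2) by (induction m) auto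

lemma conjugate_has_period:
  assumes f: "bij_betw f A A" and h: "bij_betw h A B"
    and hf: "\<forall>a\<in>A. h (f a) = g (h a)" and a: "a \<in> A"
  shows "has_period g (h a) t \<longleftrightarrow> has_period f a t"
proof -
  have "(g ^^ m) (h a) = h a \<longleftrightarrow> (f ^^ m) a = a" for m
    using conjugate_funpow[OF f hf a] funpow_mem[OF f a] h a
    by (metis bij_betw_inv_into_left)
  then show ?thesis by (simp add: has_period_def)
qed

lemma conjugate_orbits:
  assumes f: "bij_betw f A A" and g: "bij_betw g B B" and h: "bij_betw h A B"
    and hf: "\<forall>a\<in>A. h (f a) = g (h a)"
  shows "orbits g B t = image h ` orbits f A t"
proof -
  have orb: "orbit g B (h a) = h ` orbit f A a" if a: "a \<in> A" for a
  proof -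
    have "(g ^^ m) (h a) = (g ^^ n) (h b) \<longleftrightarrow> (f ^^ m) a = (f ^^ n) b" if b: "b \<in> A" for b m n
      using conjugate_funpow[OF f hf a] conjugate_funpow[OF f hf b] funpow_mem[OF f a] funpow_mem[OF f b] h
      by (metis bij_betw_inv_into_left)
    moreover have "B = h ` A" using h by (simp add: bij_betw_def)
    ultimately show ?thesis by (auto simp: orbit_def intro!: imageI; blast)
  qed
  have "{b \<in> B. has_period g b t} = h ` {a \<in> A. has_period f a t}"
    using conjugate_has_period[OF f h hf] h by (auto simp: bij_betw_def)
  then show ?thesis unfolding orbits_def using orb by (auto simp: image_image)
qed

section \<open>Automorphisms of groups of integer vectors\<close>

definition smul :: "int \<Rightarrow> ('i \<Rightarrow> int) \<Rightarrow> 'i \<Rightarrow> int" where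
  "smul k v = (\<lambda>i. k * v i)"

lemma smul_apply: "smul k v i = k * v i"
  by (simp add: smul_def)

lemma smul_simps [simp]: "smul 0 v = 0" "smul 1 v = v" "smul k 0 = 0" "smul j (smul k v) = smul (j * k) v"
  by (auto simp: fun_eq_iff smul_apply)

lemma smul_cancel: "k \<noteq> 0 \<Longrightarrow> smul k u = smul k v \<longleftrightarrow> u = v"
  by (simp add: fun_eq_iff smul_apply)

text \<open>The index type may be infinite; finite rank enters later, through a finite set of
  coordinates that determines the vectors of \<open>H\<close>.\<close>

locale int_subgroup =
  fixes H :: "('i \<Rightarrow> int) set"
  assumes zero_mem: "0 \<in> H" and diff_mem: "u \<in> H \<Longrightarrow> v \<in> H \<Longrightarrow> u - v \<in> H"
begin

lemma uminus_mem: "u \<in> H \<Longrightarrow> - u \<in> H"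
  using diff_mem[OF zero_mem] by simp

lemma add_mem: "u \<in> H \<Longrightarrow> v \<in> H \<Longrightarrow> u + v \<in> H"
  using diff_mem[of u "- v"] uminus_mem by simp

lemma smul_mem:
  assumes "v \<in> H" shows "smul k v \<in> H"
proof (induction k rule: int_induct[where k = 0])
  case base
  then show ?case using zero_mem by (simp only: smul_simps)
next
  case (step1 k)
  have "smul (k + 1) v = smul k v + v" by (simp add: fun_eq_iff smul_apply distrib_right)
  then show ?case using step1 add_mem assms by metis
next
  case (step2 k)
  have "smul (k - 1) v = smul k v - v" by (simp add: fun_eq_iff smul_apply left_diff_distrib)
  then show ?case using step2 diff_mem assms by metis
qed

lemma kernel: "int_subgroup {v \<in> H. v i = 0}"
  using zero_mem diff_mem by unfold_locales auto

end

text \<open>Equivalently, each vector of \<open>H\<close> has a nonzero multiple in the group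
  generated by \<open>F\<close>. Phrasing it as an induction principle avoids integer
  combinations.\<close>

definition saturated_span :: "('i \<Rightarrow> int) set \<Rightarrow> ('i \<Rightarrow> int) set \<Rightarrow> bool" where
  "saturated_span F H \<longleftrightarrow> (\<forall>K. int_subgroup K \<longrightarrow> F \<subseteq> K \<longrightarrow>
    (\<forall>k. \<forall>v\<in>H. k \<noteq> 0 \<longrightarrow> smul k v \<in> K \<longrightarrow> v \<in> K) \<longrightarrow> H \<subseteq> K)"

lemma saturated_spanD:
  assumes "saturated_span F H" "int_subgroup K" "F \<subseteq> K"
    and "\<And>k v. v \<in> H \<Longrightarrow> k \<noteq> 0 \<Longrightarrow> smul k v \<in> K \<Longrightarrow> v \<in> K"
  shows "H \<subseteq> K"
  using assms(1)[unfolded saturated_span_def, rule_format, OF assms(2,3)] assms(4) by blast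

text \<open>Induction on the coordinates. Any \<open>u\<close> with \<open>u i \<noteq> 0\<close>
  serves as the new generator, because \<open>u i\<close> times \<open>v\<close> minus
  \<open>v i\<close> times \<open>u\<close> lies in the kernel of coordinate \<open>i\<close>.
  Working up to saturation is what allows an arbitrary such \<open>u\<close>.\<close>

lemma finite_saturated_span:
  assumes "finite I" "int_subgroup H" "\<And>v. v \<in> H \<Longrightarrow> \<forall>i\<in>I. v i = 0 \<Longrightarrow> v = 0"
  shows "\<exists>F. finite F \<and> F \<subseteq> H \<and> saturated_span F H"
  using assms
proof (induction I arbitrary: H rule: finite_induct)
  case empty
  then have "H \<subseteq> {0}" by blast
  then have "saturated_span {} H"
    unfolding saturated_span_def using int_subgroup.zero_mem by blast
  then show ?case by (metis empty_subsetI finite.emptyI)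
next
  case (insert i I)
  interpret int_subgroup H by fact
  let ?H0 = "{v \<in> H. v i = 0}"
  have "v = 0" if "v \<in> ?H0" "\<forall>i\<in>I. v i = 0" for v
    using that by (intro insert.prems(2)) auto
  from insert.IH[OF kernel[of i] this]
  obtain F0 where F0: "finite F0" "F0 \<subseteq> ?H0" and gen: "saturated_span F0 ?H0"
    by blast
  show ?case
  proof (cases "\<exists>u\<in>H. u i \<noteq> 0")
    case False
    then have "?H0 = H" by blast
    then show ?thesis using F0 gen by metis
  next
    case True
    then obtain u where u: "u \<in> H" "u i \<noteq> 0" by blast
    have "H \<subseteq> K" if K: "int_subgroup K" "insert u F0 \<subseteq> K"
      and sat: "\<forall>k. \<forall>v\<in>H. k \<noteq> 0 \<longrightarrow> smul k v \<in> K \<longrightarrow> v \<in> K" for K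
    proof
      fix v assume v: "v \<in> H"
      interpret K: int_subgroup K by fact
      have "F0 \<subseteq> K" using K(2) by blast
      then have "?H0 \<subseteq> K" by (rule saturated_spanD[OF gen K(1)]) (use sat in blast)
      moreover have "smul (u i) v - smul (v i) u \<in> ?H0"
        using diff_mem[OF smul_mem[OF v] smul_mem[OF u(1)]] by (simp add: smul_apply)
      ultimately have "smul (u i) v - smul (v i) u \<in> K" by blast
      then have "(smul (u i) v - smul (v i) u) + smul (v i) u \<in> K"
        using K.add_mem K.smul_mem K(2) by blast
      then have "smul (u i) v \<in> K" by (simp only: diff_add_cancel)
      then show "v \<in> K" using sat u v by blast
    qed
    then have "saturated_span (insert u F0) H" unfolding saturated_span_def by blast
    moreover have "insert u F0 \<subseteq> H" using F0(2) u(1) by blast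
    ultimately show ?thesis using F0(1) finite_insert by metis
  qed
qed

text \<open>The values at coordinate \<open>i\<close> form an ideal of the integers. With
  \<open>u\<close> attaining its positive generator \<open>d\<close>, the group is the direct sum of
  the kernel, free by induction, and the multiples of \<open>u\<close>.\<close>

lemma int_subgroup_free:
  assumes "finite I" "int_subgroup H" "\<And>v. v \<in> H \<Longrightarrow> \<forall>i\<in>I. v i = 0 \<Longrightarrow> v = 0"
  shows "\<exists>r \<phi>. bij_betw \<phi> {x :: nat \<Rightarrow> int. \<forall>i\<ge>r. x i = 0} H \<and>
    (\<forall>x y. (\<forall>i\<ge>r. x i = 0) \<longrightarrow> (\<forall>i\<ge>r. y i = 0) \<longrightarrow> \<phi> (x + y) = \<phi> x + \<phi> y)"
  using assms
proof (induction I arbitrary: H rule: finite_induct)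
  case empty
  then have "H = {0}" using int_subgroup.zero_mem by blast
  moreover have "{x :: nat \<Rightarrow> int. \<forall>i\<ge>0. x i = 0} = {0}" by auto
  ultimately have "bij_betw (\<lambda>_. 0) {x :: nat \<Rightarrow> int. \<forall>i\<ge>0. x i = 0} H"
    by (simp add: bij_betw_def)
  then show ?case by (intro exI[of _ 0] exI[of _ "\<lambda>_. 0"]) (simp only: add_0_left simp_thms)
next
  case (insert i I)
  interpret int_subgroup H by fact
  let ?H0 = "{v \<in> H. v i = 0}" and ?Z = "\<lambda>r. {x :: nat \<Rightarrow> int. \<forall>i\<ge>r. x i = 0}"
  have "v = 0" if "v \<in> ?H0" "\<forall>i\<in>I. v i = 0" for v
    using that by (intro insert.prems(2)) auto
  then have "\<exists>r \<phi>. bij_betw \<phi> (?Z r) ?H0 \<and>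
    (\<forall>x y. (\<forall>i\<ge>r. x i = 0) \<longrightarrow> (\<forall>i\<ge>r. y i = 0) \<longrightarrow> \<phi> (x + y) = \<phi> x + \<phi> y)"
    by (rule insert.IH[OF kernel[of i]])
  then obtain r \<phi> where \<phi>: "bij_betw \<phi> (?Z r) ?H0"
    and add: "\<And>x y. x \<in> ?Z r \<Longrightarrow> y \<in> ?Z r \<Longrightarrow> \<phi> (x + y) = \<phi> x + \<phi> y"
    by auto
  show ?case
  proof (cases "\<exists>u\<in>H. u i \<noteq> 0")
    case False
    then have "?H0 = H" by blast
    then have "bij_betw \<phi> (?Z r) H" using \<phi> by (simp only:)
    then show ?thesis using add by blast
  next
    case True
    then obtain u0 where u0: "u0 \<in> H" "u0 i \<noteq> 0" by blast
    let ?P = "\<lambda>n. \<exists>u\<in>H. u i = int n \<and> n > 0"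
    have "?P (nat \<bar>u0 i\<bar>)"
      using u0 uminus_mem[OF u0(1)] by (cases "u0 i > 0") (force intro: bexI[of _ u0] bexI[of _ "- u0"])+
    define d where "d = (LEAST n. ?P n)"
    have "?P d" unfolding d_def using \<open>?P (nat \<bar>u0 i\<bar>)\<close> by (rule LeastI)
    then obtain u where u: "u \<in> H" "u i = int d" "d > 0" by blast
    have dvd: "int d dvd v i" if v: "v \<in> H" for v
    proof (rule ccontr)
      assume "\<not> int d dvd v i"
      then have pos: "v i mod int d > 0" 
        using u(3) pos_mod_sign[of "int d" "v i"] by (metis dvd_eq_mod_eq_0 le_less of_nat_0_less_iff)
      let ?w = "v - smul (v i div int d) u"
      have "?w \<in> H" using v u diff_mem smul_mem by blast
      moreover have "?w i = v i mod int d"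
        using u(2) by (simp add: smul_apply minus_div_mult_eq_mod)
      ultimately have "?P (nat (v i mod int d))" using pos by (intro bexI[of _ ?w]) auto
      moreover have "nat (v i mod int d) < d" using u(3) by (simp add: nat_less_iff)
      ultimately show False using not_less_Least unfolding d_def by blast
    qed
    \<comment> \<open>The new coordinate \<open>r\<close> holds the coefficient of \<open>u\<close>;
      clearing it leaves an argument for the old basis map.\<close>
    define \<psi> where "\<psi> x = \<phi> (x(r := 0)) + smul (x r) u" for x :: "nat \<Rightarrow> int"
    have upd: "x(r := 0) \<in> ?Z r" if "x \<in> ?Z (Suc r)" for x
      using that by (auto simp: le_Suc_eq Suc_le_eq)
    have \<phi>H: "\<phi> x \<in> H \<and> \<phi> x i = 0" if "x \<in> ?Z r" for x
      using bij_betwE[OF \<phi>] that by blast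
    have "bij_betw \<psi> (?Z (Suc r)) H"
    proof (rule bij_betw_imageI)
      show "inj_on \<psi> (?Z (Suc r))"
      proof (rule inj_onI)
        fix x y assume x: "x \<in> ?Z (Suc r)" and y: "y \<in> ?Z (Suc r)" and eq: "\<psi> x = \<psi> y"
        have "\<psi> x i = \<psi> y i" using eq by simp
        then have "x r = y r"
          using \<phi>H[OF upd[OF x]] \<phi>H[OF upd[OF y]] u by (simp add: \<psi>_def smul_apply)
        then have "\<phi> (x(r := 0)) = \<phi> (y(r := 0))" using eq by (simp add: \<psi>_def)
        then have "x(r := 0) = y(r := 0)"
          using \<phi> upd[OF x] upd[OF y] by (meson bij_betw_def inj_onD)
        then show "x = y" using \<open>x r = y r\<close> by (metis fun_upd_triv fun_upd_upd)
      qed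
      show "\<psi> ` ?Z (Suc r) = H"
      proof (intro equalityI subsetI)
        fix v assume "v \<in> \<psi> ` ?Z (Suc r)"
        then obtain x where "x \<in> ?Z (Suc r)" "v = \<psi> x" by blast
        then show "v \<in> H" using \<phi>H[OF upd] add_mem smul_mem u by (simp add: \<psi>_def)
      next
        fix v assume v: "v \<in> H"
        obtain q where q: "v i = int d * q" using dvd[OF v] by blast
        have "v - smul q u \<in> ?H0" using v u q diff_mem smul_mem by (simp add: smul_apply mult.commute)
        then obtain x where x: "x \<in> ?Z r" "\<phi> x = v - smul q u"
          using \<phi> unfolding bij_betw_def by (metis (no_types, lifting) imageE)
        have "x(r := 0) = x" using x(1) by auto
        then have "\<psi> (x(r := q)) = v" using x(2) by (simp add: \<psi>_def)
        moreover have "x(r := q) \<in> ?Z (Suc r)" using x(1) by auto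
        ultimately show "v \<in> \<psi> ` ?Z (Suc r)" by blast
      qed
    qed
    moreover have "\<psi> (x + y) = \<psi> x + \<psi> y" if "x \<in> ?Z (Suc r)" "y \<in> ?Z (Suc r)" for x y
    proof -
      have "(x + y)(r := 0) = x(r := 0) + y(r := 0)" by (auto simp: fun_eq_iff)
      then have "\<phi> ((x + y)(r := 0)) = \<phi> (x(r := 0)) + \<phi> (y(r := 0))"
        using add[OF upd upd] that by simp
      then show ?thesis by (simp add: \<psi>_def fun_eq_iff smul_apply algebra_simps)
    qed
    ultimately show ?thesis by blast
  qed
qed

section \<open>Automorphisms and the periods they produce\<close>

locale int_automorphism = int_subgroup H for H :: "('i \<Rightarrow> int) set" +
  fixes g :: "('i \<Rightarrow> int) \<Rightarrow> 'i \<Rightarrow> int"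
  assumes bij: "bij_betw g H H"
    and g_add: "u \<in> H \<Longrightarrow> v \<in> H \<Longrightarrow> g (u + v) = g u + g v"
begin

lemma g_zero: "g 0 = 0"
  using g_add[OF zero_mem zero_mem] by simp

lemma g_diff:
  assumes "u \<in> H" "v \<in> H" shows "g (u - v) = g u - g v"
  using g_add[OF diff_mem[OF assms] assms(2)] by (simp add: algebra_simps)

lemma g_smul:
  assumes "v \<in> H" shows "g (smul k v) = smul k (g v)"
proof (induction k rule: int_induct[where k = 0])
  case base
  then show ?case using g_zero by (simp only: smul_simps)
next
  case (step1 k)
  have "smul (k + 1) w = smul k w + w" for w :: "'i \<Rightarrow> int"
    by (simp add: fun_eq_iff smul_apply distrib_right)
  then show ?case using step1 g_add smul_mem assms by metis
next
  case (step2 k)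
  have "smul (k - 1) w = smul k w - w" for w :: "'i \<Rightarrow> int"
    by (simp add: fun_eq_iff smul_apply left_diff_distrib)
  then show ?case using step2 g_diff smul_mem assms by metis
qed

lemma funpow: "int_automorphism H (g ^^ m)"
proof
  show "bij_betw (g ^^ m) H H" by (rule bij_betw_funpow[OF bij])
  show "(g ^^ m) (u + v) = (g ^^ m) u + (g ^^ m) v" if "u \<in> H" "v \<in> H" for u v
    using that funpow_mem[OF bij] by (induction m) (simp_all add: g_add)
qed

lemmas funpow_add = int_automorphism.g_add[OF funpow]
lemmas funpow_smul = int_automorphism.g_smul[OF funpow]
lemmas funpow_zero = int_automorphism.g_zero[OF funpow]
lemmas funpow_diff = int_automorphism.g_diff[OF funpow]

lemma has_period_smul:
  assumes "v \<in> H" "k \<noteq> 0"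
  shows "has_period g (smul k v) t \<longleftrightarrow> has_period g v t"
  using assms by (simp add: has_period_def funpow_smul smul_cancel)

lemma infinite_orbits:
  assumes v: "v \<in> H" "v \<noteq> 0" and t: "has_period g v t"
  shows "infinite (orbits g H t)"
proof -
  \<comment> \<open>The multiples of \<open>v\<close> by powers of 2 lie in distinct orbits, because divisibility by \<open>2 ^ c\<close>
    inside \<open>H\<close> is constant on orbits.\<close>
  define D where "D c w \<longleftrightarrow> (\<exists>x\<in>H. w = smul (2 ^ c) x)" for c :: nat and w
  have D_funpow: "D c ((g ^^ m) w) \<longleftrightarrow> D c w" if w: "w \<in> H" for c m w
  proof
    assume "D c ((g ^^ m) w)"
    then obtain x where x: "x \<in> H" "(g ^^ m) w = smul (2 ^ c) x" by (auto simp: D_def)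
    obtain y where y: "y \<in> H" "(g ^^ m) y = x" using funpow_surj[OF bij x(1)] by blast
    have "(g ^^ m) w = (g ^^ m) (smul (2 ^ c) y)" using x y funpow_smul by simp
    then have "w = smul (2 ^ c) y" using funpow_inj[OF bij w smul_mem[OF y(1)]] by blast
    then show "D c w" using y(1) by (auto simp: D_def)
  next
    assume "D c w"
    then obtain x where "x \<in> H" "w = smul (2 ^ c) x" by (auto simp: D_def)
    then show "D c ((g ^^ m) w)" using funpow_smul funpow_mem[OF bij] unfolding D_def by blast
  qed
  let ?o = "\<lambda>a :: nat. orbit g H (smul (2 ^ a) v)"
  have "?o a \<noteq> ?o b" if ab: "a < b" for a b
  proof
    assume "?o a = ?o b"
    then obtain m n where mn: "(g ^^ m) (smul (2 ^ b) v) = (g ^^ n) (smul (2 ^ a) v)"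
      using orbit_eq_iff[OF bij smul_mem[OF v(1)] smul_mem[OF v(1)]] by blast
    have same: "D c (smul (2 ^ b) v) \<longleftrightarrow> D c (smul (2 ^ a) v)" for c
      using D_funpow[OF smul_mem[OF v(1)]] mn by metis
    \<comment> \<open>If \<open>2 ^ c\<close> divides \<open>2 ^ a\<close> times \<open>v\<close>,
      then \<open>2 ^ Suc c\<close> divides \<open>2 ^ b\<close> times \<open>v\<close>, because
      \<open>a < b\<close>. The common orbit carries this back to \<open>2 ^ a\<close> times
      \<open>v\<close>, so the exponent grows without bound.\<close>
    have D: "D c (smul (2 ^ a) v)" for c
    proof (induction c)
      case 0
      have "smul (2 ^ a) v = smul (2 ^ 0) (smul (2 ^ a) v)" by (simp only: power_0 smul_simps mult_1)
      then show ?case using smul_mem[OF v(1)] unfolding D_def by blast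
    next
      case (Suc c)
      then obtain x where x: "x \<in> H" "smul (2 ^ a) v = smul (2 ^ c) x" by (auto simp: D_def)
      have "b = (b - a - 1) + 1 + a" using ab by simp
      then have "smul (2 ^ b) v = smul (2 * 2 ^ (b - a - 1)) (smul (2 ^ a) v)"
        by (metis (no_types, lifting) mult.commute power_add power_one_right smul_simps(4))
      also have "\<dots> = smul (2 ^ Suc c) (smul (2 ^ (b - a - 1)) x)"
        by (simp add: x(2) ac_simps)
      finally show ?case using same smul_mem[OF x(1)] unfolding D_def by blast
    qed
    obtain i where "v i \<noteq> 0" using v(2) by (auto simp: fun_eq_iff)
    \<comment> \<open>A nonzero integer z is not divisible by 2^|z|, which exceeds |z|.\<close>
    let ?z = "2 ^ a * v i"
    have "?z \<noteq> 0" using \<open>v i \<noteq> 0\<close> by simp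
    have "2 ^ c dvd ?z" for c
    proof -
      obtain x where "smul (2 ^ a) v = smul (2 ^ c) x" using D[of c] by (auto simp: D_def)
      then have "?z = 2 ^ c * x i" by (metis smul_apply)
      then show ?thesis by simp
    qed
    then have "2 ^ nat \<bar>?z\<bar> \<le> \<bar>?z\<bar>"
      using dvd_imp_le_int[OF \<open>?z \<noteq> 0\<close>] by (metis abs_numeral power_abs)
    moreover have "\<bar>?z\<bar> < 2 ^ nat \<bar>?z\<bar>"
      using of_nat_less_iff[where 'a = int, THEN iffD2, OF less_exp[of "nat \<bar>?z\<bar>"]]
      by (simp only: of_nat_power of_nat_numeral nat_0_le abs_ge_zero)
    ultimately show False by linarith
  qed
  then have "inj ?o" by (metis (no_types, lifting) injI linorder_neqE_nat)
  then have "infinite (range ?o)" by (simp add: finite_image_iff)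
  moreover have "range ?o \<subseteq> orbits g H t"
    using smul_mem[OF v(1)] has_period_smul[OF v(1)] t by (auto simp: orbits_def)
  ultimately show ?thesis using infinite_super by blast
qed

text \<open>The sum of \<open>u\<close> and \<open>v\<close> alone may have too small a period, as
  for \<open>v = - u\<close>; hence the whole family of vectors u + k v. If two members share a
  period m, the m-th iterate fixes both, hence their difference, a nonzero multiple of
  \<open>v\<close>. It therefore fixes \<open>v\<close> and \<open>u\<close>, and m is a multiple of
  the lcm.\<close>

lemma period_lcm:
  assumes u: "u \<in> H" "has_period g u \<alpha>" and v: "v \<in> H" "has_period g v \<beta>"
    and pos: "\<alpha> > 0" "\<beta> > 0"
  shows "\<exists>w\<in>H. has_period g w (lcm \<alpha> \<beta>)"
proof -
  let ?w = "\<lambda>k :: nat. u + smul (int k) v" and ?L = "lcm \<alpha> \<beta>"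
  have w: "?w k \<in> H" for k using add_mem smul_mem u v by blast
  have pow: "(g ^^ m) (?w k) = (g ^^ m) u + smul (int k) ((g ^^ m) v)" for m k
    using funpow_add[OF u(1) smul_mem[OF v(1)]] funpow_smul[OF v(1)] by simp
  have "\<exists>t. has_period g (?w k) t" for k by (rule has_period_exists)
  then obtain p where p: "\<And>k. has_period g (?w k) (p k)" by metis
  have pL: "p k dvd ?L" for k
  proof -
    have "(g ^^ ?L) u = u" "(g ^^ ?L) v = v" using u v by (auto simp: has_period_def)
    then show ?thesis using p[of k] pow[of ?L k] by (simp add: has_period_def)
  qed
  have "finite {d. d dvd ?L}" using pos by (simp add: lcm_pos_nat)
  moreover have "range p \<subseteq> {d. d dvd ?L}" using pL by blast
  ultimately have "finite (range p)" by (rule rev_finite_subset)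
  then have "\<not> inj p" using finite_imageD infinite_UNIV_nat by blast
  then obtain j k where jk: "j \<noteq> k" "p j = p k" by (auto simp: inj_def)
  let ?m = "p k"
  have "(g ^^ ?m) (?w k) = ?w k" "(g ^^ ?m) (?w j) = ?w j"
    using p[of k] p[of j] jk(2) by (auto simp: has_period_def)
  then have eqs: "(g ^^ ?m) u i + int k * (g ^^ ?m) v i = u i + int k * v i"
    "(g ^^ ?m) u i + int j * (g ^^ ?m) v i = u i + int j * v i" for i
    unfolding pow by (metis plus_fun_apply smul_apply)+
  have "(int k - int j) * ((g ^^ ?m) v i - v i) = 0" for i
    using eqs[of i] by (simp add: algebra_simps)
  then have gv: "(g ^^ ?m) v = v" using jk(1) by (auto simp: fun_eq_iff)
  then have "(g ^^ ?m) u = u" using eqs(1) by (auto simp: fun_eq_iff)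
  then have "?L dvd ?m" using gv u v by (simp add: has_period_def)
  then have "?m = ?L" using pL by (simp add: dvd_antisym)
  then show ?thesis using p[of k] w[of k] by auto
qed

text \<open>For any N the vectors fixed by \<open>g ^^ N\<close> form a subgroup that is closed
  under division by nonzero integers. It contains all periodic vectors once it contains a set
  spanning them up to saturation, so the product of the finitely many periods of such a set can
  serve as N.\<close>

lemma common_period:
  assumes "finite I" "\<And>v. v \<in> H \<Longrightarrow> \<forall>i\<in>I. v i = 0 \<Longrightarrow> v = 0"
  shows "\<exists>N>0. \<forall>v\<in>H. \<forall>t>0. has_period g v t \<longrightarrow> t dvd N"
proof -
  define P where "P = {v \<in> H. \<exists>m>0. (g ^^ m) v = v}"
  have mult: "(g ^^ (n * m)) v = v" if "(g ^^ m) v = v" for m n v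
    using that by (induction n) (simp_all add: funpow_plus)
  have P: "int_subgroup P"
  proof
    show "0 \<in> P" using zero_mem funpow_zero by (auto simp: P_def)
    fix u v assume "u \<in> P" "v \<in> P"
    then obtain m n where m: "u \<in> H" "m > 0" "(g ^^ m) u = u" and n: "v \<in> H" "n > 0" "(g ^^ n) v = v"
      by (auto simp: P_def)
    have "(g ^^ (n * m)) u = u" "(g ^^ (n * m)) v = v"
      using mult[OF m(3), of n] mult[OF n(3), of m] by (simp_all only: mult.commute)
    then have "(g ^^ (n * m)) (u - v) = u - v" using funpow_diff m n by simp
    moreover have "n * m > 0" using m n by simp
    ultimately show "u - v \<in> P" using diff_mem m n unfolding P_def by blast
  qed
  have "v = 0" if "v \<in> P" "\<forall>i\<in>I. v i = 0" for v
    using that assms(2) unfolding P_def by blast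
  from finite_saturated_span[OF assms(1) P this]
  obtain F where F: "finite F" "F \<subseteq> P" and gen: "saturated_span F P"
    by blast
  have "\<exists>m>0. (g ^^ m) v = v" if "v \<in> F" for v using that F(2) by (auto simp: P_def)
  then obtain q where q: "\<And>v. v \<in> F \<Longrightarrow> q v > 0 \<and> (g ^^ q v) v = v" by metis
  let ?N = "\<Prod>v\<in>F. q v"
  let ?K = "{v \<in> H. (g ^^ ?N) v = v}"
  have "int_subgroup ?K"
    using zero_mem diff_mem funpow_zero funpow_diff by unfold_locales auto
  moreover have "F \<subseteq> ?K"
  proof
    fix v assume v: "v \<in> F"
    then have "q v dvd ?N" using F(1) by (simp add: dvd_prodI)
    then obtain n where "?N = n * q v" by (metis dvd_def mult.commute)
    then show "v \<in> ?K" using mult q[OF v] v F(2) by (auto simp: P_def)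
  qed
  moreover have "v \<in> ?K" if "v \<in> P" "k \<noteq> 0" "smul k v \<in> ?K" for k v
  proof -
    have v: "v \<in> H" using that(1) by (simp add: P_def)
    have "smul k ((g ^^ ?N) v) = smul k v" using that(3) funpow_smul[OF v] by simp
    then show ?thesis using v that(2) smul_cancel by blast
  qed
  ultimately have PK: "P \<subseteq> ?K" by (rule saturated_spanD[OF gen])
  have "t dvd ?N" if "v \<in> H" "t > 0" "has_period g v t" for v t
  proof -
    have "(g ^^ t) v = v" using that(3) by (simp add: has_period_def)
    then have "v \<in> P" using that by (auto simp: P_def)
    then show ?thesis using PK that(3) by (auto simp: has_period_def)
  qed
  moreover have "?N > 0" using q by (simp add: prod_pos)
  ultimately show ?thesis by blast
qed

end

section \<open>Shift-invariant groups of integer sequences\<close>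

text \<open>For \<open>k > 0\<close> the conditions say that the shift \<open>s\<close> satisfies \<open>s ^ k = 1\<close> and, for every prime
  \<open>p\<close> dividing \<open>k\<close>, \<open>\<Sum>j<p. s ^ (j * (k div p)) = 0\<close>; thus \<open>s\<close> acts like a primitive \<open>k\<close>-th root of
  unity and every nonzero sequence has minimal period exactly \<open>k\<close>. For \<open>k = 0\<close> the shift is
  hyperbolic.\<close>

definition seqs :: "nat \<Rightarrow> (nat \<Rightarrow> int) set" where
  "seqs k = (if k = 0 then {x. \<forall>i. x (i + 2) = 3 * x (i + 1) - x i}
    else {x. (\<forall>i. x (i + k) = x i) \<and>
      (\<forall>p. prime p \<longrightarrow> p dvd k \<longrightarrow> (\<forall>i. (\<Sum>j<p. x (i + j * (k div p))) = 0))})"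

lemma periodic_mult:
  fixes x :: "nat \<Rightarrow> 'a"
  assumes "\<And>i. x (i + m) = x i" shows "x (i + n * m) = x i"
proof (induction n)
  case (Suc n)
  have "x (i + Suc n * m) = x ((i + n * m) + m)" by (simp add: ac_simps)
  then show ?case using Suc assms by simp
qed simp

lemma periodic_cong:
  fixes x :: "nat \<Rightarrow> 'a"
  assumes "\<And>i. x (i + m) = x i" "[a = b] (mod m)" shows "x a = x b"
proof -
  have "x a = x (a mod m)" for a
    using periodic_mult[of x m "a mod m" "a div m", OF assms(1)] by simp
  then show ?thesis using assms(2) by (metis cong_def)
qed

lemma seqs_period:
  assumes x: "x \<in> seqs k" and nz: "x j \<noteq> 0"
  shows "(\<forall>i. x (i + m) = x i) \<longleftrightarrow> k dvd m"
proof
  assume per: "\<forall>i. x (i + m) = x i"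
  show "k dvd m"
  proof (cases "k = 0")
    case True
    \<comment> \<open>A nonzero periodic solution contradicts the recurrence where its absolute value is maximal.\<close>
    have rec: "x (i + 2) = 3 * x (i + 1) - x i" for i using x True by (simp add: seqs_def)
    have "m = 0"
    proof (rule ccontr)
      assume "m \<noteq> 0"
      let ?B = "(\<lambda>i. \<bar>x i\<bar>) ` {..<m}"
      have fin: "finite ?B" "?B \<noteq> {}" using \<open>m \<noteq> 0\<close> by (auto simp: lessThan_empty_iff)
      have le: "\<bar>x i\<bar> \<le> Max ?B" for i
      proof -
        have "x i = x (i mod m)" using periodic_cong[of x m i "i mod m"] per by (simp add: cong_def)
        moreover have "\<bar>x (i mod m)\<bar> \<in> ?B" using \<open>m \<noteq> 0\<close> by simp
        ultimately show ?thesis using Max_ge[OF fin(1)] by simp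
      qed
      obtain l where l: "\<bar>x l\<bar> = Max ?B" using Max_in[OF fin] by auto
      \<comment> \<open>Since \<open>l\<close> may be 0, the recurrence is read around
        \<open>l + m\<close>, which has a predecessor. Maximality then turns it into 3 |x l| \<le> 2
        |x l|.\<close>
      have "x (l + m) = x l" using per by blast
      moreover have "l + m = (l + m - 1) + 1" "l + m + 1 = (l + m - 1) + 2" using \<open>m \<noteq> 0\<close> by auto
      ultimately have "3 * x l = x (l + m + 1) + x (l + m - 1)"
        using rec[of "l + m - 1"] by (metis add.commute diff_add_cancel)
      then have "3 * \<bar>x l\<bar> \<le> \<bar>x (l + m + 1)\<bar> + \<bar>x (l + m - 1)\<bar>" by linarith
      then have "\<bar>x l\<bar> \<le> 0" using le[of "l + m + 1"] le[of "l + m - 1"] l by linarith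
      then show False using le[of j] nz l by linarith
    qed
    then show ?thesis by simp
  next
    case False
    then have perk: "\<And>i. x (i + k) = x i"
      and sum: "\<And>p i. prime p \<Longrightarrow> p dvd k \<Longrightarrow> (\<Sum>j<p. x (i + j * (k div p))) = 0"
      using x by (auto simp: seqs_def)
    have perd: "x (i + gcd m k) = x i" for i
    proof (cases "m = 0")
      case True then show ?thesis using perk by simp
    next
      case False
      then obtain a b where ab: "m * a = k * b + gcd m k" using bezout_nat by blast
      have "x (i + gcd m k) = x ((i + gcd m k) + b * k)" using periodic_mult[of x k, OF perk] by simp
      also have "(i + gcd m k) + b * k = i + a * m" using ab by (simp add: mult.commute)
      also have "x \<dots> = x i" using periodic_mult[of x m] per by simp
      finally show ?thesis .
    qed
    show ?thesis
    proof (rule ccontr)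
      \<comment> \<open>As a proper divisor of \<open>k\<close>, the period \<open>gcd m k\<close>
        divides \<open>k div p\<close> for some prime \<open>p\<close>. All terms of the vanishing
        sum at \<open>j\<close> then equal \<open>x j\<close>, so
        \<open>p * x j = 0\<close>.\<close>
      assume "\<not> k dvd m"
      obtain e where e: "k = gcd m k * e" by (metis dvd_def gcd_dvd2)
      have "e \<noteq> 1" using \<open>\<not> k dvd m\<close> e by (metis gcd_dvd1 mult.right_neutral)
      then obtain p where p: "prime p" "p dvd e" using prime_factor_nat by blast
      then obtain r where r: "e = p * r" by blast
      have "k = p * (r * gcd m k)" using e r by (simp add: ac_simps)
      then have "p dvd k" "k div p = r * gcd m k"
        using p(1) by (metis dvd_triv_left, metis nonzero_mult_div_cancel_left not_prime_0)
      then have "(\<Sum>l<p. x (j + l * r * gcd m k)) = 0"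
        using sum[OF p(1), of j] by (simp add: ac_simps)
      moreover have "x (j + l * r * gcd m k) = x j" for l
        using periodic_mult[of x "gcd m k", OF perd] by blast
      ultimately show False using nz p(1) by simp
    qed
  qed
next
  assume "k dvd m"
  then obtain n where n: "m = n * k" by (metis dvd_def mult.commute)
  show "\<forall>i. x (i + m) = x i"
  proof (cases "k = 0")
    case False
    then have "\<And>i. x (i + k) = x i" using x by (simp add: seqs_def)
    then show ?thesis using periodic_mult n by metis
  qed (simp add: n)
qed

section \<open>Nonzero sequences for every length\<close>

fun hyperbolic_seq :: "nat \<Rightarrow> int" where
  "hyperbolic_seq 0 = 0"
| "hyperbolic_seq (Suc 0) = 1"
| "hyperbolic_seq (Suc (Suc n)) = 3 * hyperbolic_seq (Suc n) - hyperbolic_seq n"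

text \<open>Spreading a sequence out with zeros reflects the identity Phi_(pm)(t) = Phi_m(t^p) for p
  dividing m. The primes dividing \<open>p * m\<close> are those dividing \<open>m\<close>, and each
  sum stays in one residue class modulo \<open>p\<close>, where it is zero termwise or a sum for
  \<open>x\<close>.\<close>

lemma seqs_mult_dividing_prime:
  assumes x: "x \<in> seqs m" and m: "m > 0" and p: "prime p" "p dvd m"
  shows "(\<lambda>i. if p dvd i then x (i div p) else 0) \<in> seqs (p * m)" (is "?y \<in> _")
proof -
  have "p > 0" using p(1) by (rule prime_gt_0_nat)
  have per: "\<And>i. x (i + m) = x i"
    and sum: "\<And>q i. prime q \<Longrightarrow> q dvd m \<Longrightarrow> (\<Sum>j<q. x (i + j * (m div q))) = 0"
    using x m by (auto simp: seqs_def)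
  have shift: "?y (i + p * n) = (if p dvd i then x (i div p + n) else 0)" for i n
    using \<open>p > 0\<close> by (simp add: dvd_add_left_iff)
  have "?y (i + p * m) = ?y i" for i using shift per by simp
  moreover have "(\<Sum>j<q. ?y (i + j * (p * m div q))) = 0" if q: "prime q" "q dvd p * m" for q i
  proof -
    have "q dvd m" using q p by (metis prime_dvd_mult_iff primes_dvd_imp_eq)
    then have "p * m div q = p * (m div q)" by (simp only: div_mult_swap)
    then have "j * (p * m div q) = p * (j * (m div q))" for j
      by (simp only: mult.left_commute)
    then have "(\<Sum>j<q. ?y (i + j * (p * m div q))) = (\<Sum>j<q. if p dvd i then x (i div p + j * (m div q)) else 0)"
      by (simp only: shift)
    also have "\<dots> = 0"
      using sum[OF q(1) \<open>q dvd m\<close>, of "i div p"] by (cases "p dvd i") simp_all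
    finally show ?thesis .
  qed
  ultimately show ?thesis using m \<open>p > 0\<close> by (simp add: seqs_def)
qed

text \<open>A primitive m-th root of unity times a primitive p-th root is a primitive pm-th root.
  Accordingly \<open>x\<close> is multiplied by a sequence \<open>D\<close> of period
  \<open>p\<close> with vanishing sums, after the two arguments are decoupled as in the Chinese
  remainder theorem.\<close>

lemma seqs_mult_coprime_prime:
  assumes x: "x \<in> seqs m" "x l \<noteq> 0" and m: "m > 0" and p: "prime p" "\<not> p dvd m"
  shows "\<exists>z\<in>seqs (p * m). \<exists>i. z i \<noteq> 0"
proof -
  have "p > 1" using p(1) by (rule prime_gt_1_nat)
  have per: "\<And>i. x (i + m) = x i"
    and sum: "\<And>q i. prime q \<Longrightarrow> q dvd m \<Longrightarrow> (\<Sum>j<q. x (i + j * (m div q))) = 0"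
    using x m by (auto simp: seqs_def)
  have cop: "coprime p m" using p by (simp add: prime_imp_coprime)
  \<comment> \<open>The inverses are chosen so that a step by \<open>p\<close> in the index moves
    the argument of \<open>x\<close> by 1 modulo \<open>m\<close> and fixes that of \<open>D\<close>
    modulo \<open>p\<close>, while a step by \<open>m\<close> does the reverse.\<close>
  obtain c where c: "[p * c = 1] (mod m)" using cong_solve_coprime_nat[OF cop] by auto
  obtain d where d: "[m * d = 1] (mod p)"
    using cong_solve_coprime_nat[of m p] cop by (auto simp: coprime_commute)
  define E :: "nat \<Rightarrow> int" where "E i = (if p dvd i then 1 else 0)" for i
  \<comment> \<open>\<open>D\<close> is 1 at multiples of \<open>p\<close>, -1 just before them and
    0 elsewhere; as a difference of periodic values it telescopes to 0 over a period.\<close>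
  define D where "D i = E i - E (Suc i)" for i
  have E_per: "E (i + p) = E i" for i by (simp add: E_def)
  have D_per: "D (i + p) = D i" for i using E_per[of i] E_per[of "Suc i"] by (simp add: D_def)
  have D_sum: "(\<Sum>j<p. D (a + j)) = 0" for a
    using sum_lessThan_telescope'[of "\<lambda>j. E (a + j)" p] E_per[of a] by (simp add: D_def)
  note x_cong = periodic_cong[of x m, OF per] and D_cong = periodic_cong[of D p, OF D_per]
  let ?z = "\<lambda>i. x (c * i) * D (d * i)"
  have "?z (i + p * m) = ?z i" for i
  proof -
    have "x (c * (i + p * m)) = x (c * i)" by (rule x_cong) (simp add: cong_def distrib_left mult.assoc[symmetric])
    moreover have "D (d * (i + p * m)) = D (d * i)" by (rule D_cong) (simp add: cong_def distrib_left mult.left_commute[of d p])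
    ultimately show ?thesis by simp
  qed
  moreover have "(\<Sum>j<q. ?z (i + j * (p * m div q))) = 0" if q: "prime q" "q dvd p * m" for q i
  proof (cases "q = p")
    case True
    \<comment> \<open>The step is \<open>m\<close>: the factor \<open>x\<close> is constant and
      \<open>D\<close> runs through a full period.\<close>
    have "?z (i + j * (p * m div q)) = x (c * i) * D (d * i + j)" for j
    proof -
      have "[d * (i + j * m) = d * i + j * 1] (mod p)"
        using cong_add[OF cong_refl[of "d * i"] cong_mult[OF cong_refl[of j] d]]
        by (simp add: distrib_left ac_simps)
      then have "D (d * (i + j * m)) = D (d * i + j)" using D_cong by simp
      moreover have "x (c * (i + j * m)) = x (c * i)"
        by (rule x_cong) (simp add: cong_def distrib_left mult.assoc[symmetric])
      ultimately show ?thesis using True \<open>p > 1\<close> by simp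
    qed
    then have "(\<Sum>j<q. ?z (i + j * (p * m div q))) = x (c * i) * (\<Sum>j<p. D (d * i + j))"
      using True by (simp only: sum_distrib_left)
    then show ?thesis using D_sum by simp
  next
    case False
    then have "q dvd m" using q p by (metis prime_dvd_mult_iff primes_dvd_imp_eq)
    then have e: "p * m div q = p * (m div q)" by (simp only: div_mult_swap)
    \<comment> \<open>The step is a multiple of \<open>p\<close>: now \<open>D\<close> is constant
      and the sum for \<open>x\<close> at the prime \<open>q\<close> remains.\<close>
    have "?z (i + j * (p * m div q)) = x (c * i + j * (m div q)) * D (d * i)" for j
    proof -
      have "[j * (m div q) * (p * c) = j * (m div q) * 1] (mod m)"
        using c by (rule cong_mult[OF cong_refl])
      from cong_add[OF cong_refl[of "c * i"] this]
      have "[c * (i + j * (p * (m div q))) = c * i + j * (m div q)] (mod m)"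
        by (simp add: distrib_left ac_simps)
      then have "x (c * (i + j * (p * (m div q)))) = x (c * i + j * (m div q))" by (rule x_cong)
      moreover have "D (d * (i + j * (p * (m div q)))) = D (d * i)"
        by (rule D_cong) (simp add: cong_def distrib_left mult.left_commute[of _ p])
      ultimately show ?thesis using e by simp
    qed
    then have "(\<Sum>j<q. ?z (i + j * (p * m div q))) = (\<Sum>j<q. x (c * i + j * (m div q))) * D (d * i)"
      by (simp only: sum_distrib_right)
    then show ?thesis using sum[OF q(1) \<open>q dvd m\<close>] by simp
  qed
  ultimately have "?z \<in> seqs (p * m)" using m \<open>p > 1\<close> by (simp add: seqs_def)
  \<comment> \<open>At the index \<open>p * l\<close> the factor \<open>x\<close> takes its value at
    \<open>l\<close> and \<open>D\<close> its value at 0.\<close>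
  moreover have "?z (p * l) \<noteq> 0"
  proof -
    have "[c * (p * l) = l] (mod m)"
      using cong_mult[OF c cong_refl[of l]] by (simp add: ac_simps)
    then have "x (c * (p * l)) = x l" by (rule x_cong)
    moreover have "\<not> p dvd Suc (d * (p * l))"
      using \<open>p > 1\<close> by (metis dvd_add_right_iff dvd_mult dvd_triv_left nat_dvd_1_iff_1 less_irrefl Suc_eq_plus1)
    then have "D (d * (p * l)) = 1" by (simp add: D_def E_def)
    ultimately show ?thesis using x(2) by simp
  qed
  ultimately show ?thesis by (intro bexI[of _ ?z] exI[of _ "p * l"])
qed

text \<open>From the constant sequences at \<open>k = 1\<close> upwards, one prime at a time; the
  two constructions above handle a repeated and a new prime.\<close>

lemma seqs_nonzero: "\<exists>x\<in>seqs k. \<exists>i. x i \<noteq> 0"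
proof (induction k rule: less_induct)
  case (less k)
  consider "k = 0" | "k = 1" | "k > 1" by linarith
  then show ?case
  proof cases
    case 1
    \<comment> \<open>These are the Fibonacci numbers of even index: 0, 1, 3, 8, 21 and so
      on.\<close>
    have "hyperbolic_seq \<in> seqs k" using 1 by (simp add: seqs_def numeral_2_eq_2)
    moreover have "hyperbolic_seq 1 \<noteq> 0" by simp
    ultimately show ?thesis by blast
  next
    case 2
    have "(\<lambda>_. 1) \<in> seqs k" using 2 by (auto simp: seqs_def)
    then show ?thesis by (metis zero_neq_one)
  next
    case 3
    then obtain p where p: "prime p" "p dvd k" using prime_factor_nat by (metis less_irrefl)
    then obtain m where m: "k = p * m" by blast
    have "m > 0" using m 3 by (cases m) auto
    have "m < k" using m \<open>m > 0\<close> prime_gt_1_nat[OF p(1)] by simp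
    then obtain x l where x: "x \<in> seqs m" "x l \<noteq> 0" using less by blast
    show ?thesis
    proof (cases "p dvd m")
      case True
      let ?y = "\<lambda>i. if p dvd i then x (i div p) else 0"
      have "?y \<in> seqs k" using seqs_mult_dividing_prime[OF x(1) \<open>m > 0\<close> p(1) True] m by simp
      moreover have "?y (p * l) \<noteq> 0" using x(2) p(1) by (simp add: prime_gt_0_nat)
      ultimately show ?thesis by (intro bexI[of _ ?y] exI[of _ "p * l"])
    next
      case False
      then show ?thesis using seqs_mult_coprime_prime[OF x \<open>m > 0\<close> p(1)] m by simp
    qed
  qed
qed

section \<open>The sequences as a group of finite rank with invertible shift\<close>

lemma seqs_zero: "(\<lambda>_. 0) \<in> seqs k"
  by (simp add: seqs_def)

lemma seqs_diff:
  assumes "x \<in> seqs k" "y \<in> seqs k" shows "(\<lambda>i. x i - y i) \<in> seqs k"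
  using assms by (auto simp: seqs_def sum_subtractf)

text \<open>The bound \<open>k + 2\<close> serves both cases at once: two values start the
  recurrence when \<open>k = 0\<close>, and a full period is enough otherwise.\<close>

lemma seqs_initial:
  assumes x: "x \<in> seqs k" and init: "\<forall>i < k + 2. x i = 0" shows "x i = 0"
proof (cases "k = 0")
  case True
  then have rec: "x (i + 2) = 3 * x (i + 1) - x i" for i using x by (simp add: seqs_def)
  have "x i = 0 \<and> x (i + 1) = 0"
  proof (induction i)
    case 0 then show ?case using init by simp
  next
    case (Suc i) then show ?case using rec[of i] by simp
  qed
  then show ?thesis by blast
next
  case False
  then have "x i = x (i mod k)"
    using x periodic_cong[of x k i "i mod k"] by (simp add: seqs_def cong_def)
  also have "\<dots> = 0" using init False by (simp add: less_SucI)
  finally show ?thesis .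
qed

lemma seqs_shift:
  assumes "x \<in> seqs k" shows "(\<lambda>i. x (Suc i)) \<in> seqs k"
proof (cases "k = 0")
  case True
  have "x (Suc i + 2) = 3 * x (Suc i + 1) - x (Suc i)" for i
    using assms True unfolding seqs_def by (metis (mono_tags, lifting) mem_Collect_eq)
  then show ?thesis using True by (simp add: seqs_def)
next
  case False
  have per: "\<And>i. x (i + k) = x i"
    and sum: "\<And>p i. prime p \<Longrightarrow> p dvd k \<Longrightarrow> (\<Sum>j<p. x (i + j * (k div p))) = 0"
    using assms False by (auto simp: seqs_def)
  show ?thesis using per[of "Suc _"] sum[of _ "Suc _"] False by (simp add: seqs_def)
qed

text \<open>The value at 0 can be recovered from the later ones: through the recurrence if
  \<open>k = 0\<close>, and as \<open>x k\<close> otherwise.\<close>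

lemma seqs_shift_inj:
  assumes x: "x \<in> seqs k" and 0: "\<And>i. x (Suc i) = 0" shows "x i = 0"
proof (cases i)
  case 0
  show ?thesis
  proof (cases "k = 0")
    case True
    then have "x (0 + 2) = 3 * x (0 + 1) - x 0" using x unfolding seqs_def by auto
    then show ?thesis using assms(2)[of 0] assms(2)[of 1] \<open>i = 0\<close> by (simp add: numeral_2_eq_2)
  next
    case False
    then have "\<forall>i. x (i + k) = x i" using x by (simp add: seqs_def)
    then have "x (0 + k) = x 0" by (rule spec)
    then show ?thesis using assms(2)[of "k - 1"] False \<open>i = 0\<close> by simp
  qed
qed (use assms(2) in simp)

text \<open>The predecessor of \<open>x 0\<close> is \<open>3 * x 0 - x 1\<close>, integral because
  the constant term of t^2 - 3 t + 1 is a unit, or \<open>x (k - 1)\<close> in the periodic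
  case.\<close>

lemma seqs_shift_surj:
  assumes x: "x \<in> seqs k" shows "\<exists>y\<in>seqs k. \<forall>i. x i = y (Suc i)"
proof (cases "k = 0")
  case True
  then have rec: "x (i + 2) = 3 * x (i + 1) - x i" for i using x by (simp add: seqs_def)
  let ?y = "\<lambda>i. 3 * x i - x (i + 1)"
  have "?y \<in> seqs k" using True rec by (auto simp: seqs_def numeral_2_eq_2)
  moreover have "\<forall>i. x i = ?y (Suc i)" using rec by (simp add: numeral_2_eq_2)
  ultimately show ?thesis by (intro bexI[of _ ?y])
next
  case False
  let ?y = "\<lambda>i. x (i + (k - 1))"
  have per: "\<And>i. x (i + k) = x i"
    and sum: "\<And>p i. prime p \<Longrightarrow> p dvd k \<Longrightarrow> (\<Sum>j<p. x (i + j * (k div p))) = 0"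
    using x False by (auto simp: seqs_def)
  have "?y \<in> seqs k"
    using per[of "_ + (k - 1)"] sum[of _ "_ + (k - 1)"] False by (simp add: seqs_def ac_simps)
  moreover have "\<forall>i. x i = ?y (Suc i)" using x False by (simp add: seqs_def)
  ultimately show ?thesis by (intro bexI[of _ ?y])
qed

section \<open>A lattice automorphism with prescribed periods\<close>

text \<open>The direct sum is stored as one integer function on pairs (length, position), so that
  the results on groups of integer vectors apply to it directly.\<close>

definition seq_sum :: "nat set \<Rightarrow> (nat \<times> nat \<Rightarrow> int) set" where
  "seq_sum S = {v. \<forall>k. (\<lambda>i. v (k, i)) \<in> seqs k \<and> (k \<notin> S \<longrightarrow> (\<forall>i. v (k, i) = 0))}"

definition seq_shift :: "(nat \<times> nat \<Rightarrow> int) \<Rightarrow> nat \<times> nat \<Rightarrow> int" where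
  "seq_shift v = (\<lambda>(k, i). v (k, Suc i))"

lemma seq_shift_apply: "seq_shift v (k, i) = v (k, Suc i)"
  by (simp add: seq_shift_def)

lemma seq_shift_funpow: "(seq_shift ^^ m) v (k, i) = v (k, i + m)"
  by (induction m arbitrary: i) (simp_all add: seq_shift_apply)

lemma seq_shift_automorphism: "int_automorphism (seq_sum S) seq_shift"
proof
  show "0 \<in> seq_sum S" using seqs_zero by (simp add: seq_sum_def)
  show "u - v \<in> seq_sum S" if "u \<in> seq_sum S" "v \<in> seq_sum S" for u v
    using that seqs_diff by (simp add: seq_sum_def)
  show "seq_shift (u + v) = seq_shift u + seq_shift v" for u v
    by (rule ext) (auto simp: seq_shift_apply)
  show "bij_betw seq_shift (seq_sum S) (seq_sum S)"
  proof (rule bij_betw_imageI)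
    show "inj_on seq_shift (seq_sum S)"
    proof (rule inj_onI)
      fix u v assume uv: "u \<in> seq_sum S" "v \<in> seq_sum S" "seq_shift u = seq_shift v"
      have "u (k, i) - v (k, i) = 0" for k i
      proof (rule seqs_shift_inj[of "\<lambda>i. u (k, i) - v (k, i)" k])
        show "(\<lambda>i. u (k, i) - v (k, i)) \<in> seqs k"
          using uv seqs_diff[of "\<lambda>i. u (k, i)" k "\<lambda>i. v (k, i)"] by (simp add: seq_sum_def)
        show "u (k, Suc i) - v (k, Suc i) = 0" for i
          using uv(3) by (metis seq_shift_apply diff_self)
      qed
      then show "u = v" by (auto simp: fun_eq_iff)
    qed
    show "seq_shift ` seq_sum S = seq_sum S"
    proof (intro equalityI subsetI)
      fix w assume "w \<in> seq_shift ` seq_sum S"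
      then obtain v where "v \<in> seq_sum S" "w = seq_shift v" by blast
      then show "w \<in> seq_sum S" using seqs_shift by (auto simp: seq_sum_def seq_shift_apply)
    next
      fix w assume w: "w \<in> seq_sum S"
      have "\<exists>y\<in>seqs k. \<forall>i. w (k, i) = y (Suc i)" for k
        using w seqs_shift_surj[of "\<lambda>i. w (k, i)" k] by (simp add: seq_sum_def)
      then obtain y where y: "\<And>k. y k \<in> seqs k" "\<And>k i. w (k, i) = y k (Suc i)" by metis
      define v where "v = (\<lambda>(k, i). y k i)"
      have "y k i = 0" if "k \<notin> S" for k i
        using seqs_shift_inj[OF y(1), of k i] y(2)[of k] w that by (simp add: seq_sum_def)
      then have "v \<in> seq_sum S" using y(1) by (simp add: seq_sum_def v_def)
      moreover have "w = seq_shift v" by (rule ext) (auto simp: seq_shift_apply v_def y(2))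
      ultimately show "w \<in> seq_shift ` seq_sum S" by blast
    qed
  qed
qed

text \<open>Componentwise this is \<open>seqs_period\<close>. \<open>Lcm\<close> is 0 as soon as the
  component for 0 is nonzero, which gives a chain, and 1 for the zero vector.\<close>

lemma seq_shift_period:
  assumes v: "v \<in> seq_sum S"
  shows "has_period seq_shift v (Lcm {k. \<exists>i. v (k, i) \<noteq> 0})"
  unfolding has_period_def
proof
  fix m
  let ?K = "{k. \<exists>i. v (k, i) \<noteq> 0}"
  have "(seq_shift ^^ m) v = v \<longleftrightarrow> (\<forall>k i. v (k, i + m) = v (k, i))"
  proof
    assume "(seq_shift ^^ m) v = v"
    then show "\<forall>k i. v (k, i + m) = v (k, i)" by (metis seq_shift_funpow)
  next
    assume "\<forall>k i. v (k, i + m) = v (k, i)"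
    then have "(seq_shift ^^ m) v (k, i) = v (k, i)" for k i by (simp add: seq_shift_funpow)
    then show "(seq_shift ^^ m) v = v" by auto
  qed
  also have "\<dots> \<longleftrightarrow> (\<forall>k\<in>?K. k dvd m)"
  proof -
    have "(\<forall>i. v (k, i + m) = v (k, i)) \<longleftrightarrow> (k \<in> ?K \<longrightarrow> k dvd m)" for k
    proof (cases "k \<in> ?K")
      case True
      then obtain j where "v (k, j) \<noteq> 0" by blast
      moreover have "(\<lambda>i. v (k, i)) \<in> seqs k" using v by (simp add: seq_sum_def)
      ultimately show ?thesis using seqs_period[of "\<lambda>i. v (k, i)" k j m] True by simp
    qed simp
    then show ?thesis by blast
  qed
  also have "\<dots> \<longleftrightarrow> Lcm ?K dvd m" by (simp add: Lcm_dvd_iff)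
  finally show "(seq_shift ^^ m) v = v \<longleftrightarrow> Lcm ?K dvd m" .
qed

lemma seq_sum_single:
  assumes "k \<in> S" "x \<in> seqs k"
  shows "(\<lambda>(l, i). if l = k then x i else 0) \<in> seq_sum S"
proof -
  have "(\<lambda>i. if l = k then x i else 0) \<in> seqs l" for l
    using assms(2) seqs_zero by (cases "l = k") simp_all
  then show ?thesis using assms(1) by (simp add: seq_sum_def)
qed

lemma seq_sum_coordinates:
  assumes "v \<in> seq_sum S" "\<forall>i\<in>(SIGMA k:S. {..<k + 2}). v i = 0"
  shows "v = 0"
proof -
  have "v (k, i) = 0" for k i
  proof (cases "k \<in> S")
    case True
    have "(\<lambda>i. v (k, i)) \<in> seqs k" using assms(1) by (simp add: seq_sum_def)
    moreover have "\<forall>i<k + 2. v (k, i) = 0" using assms(2) True by simp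
    ultimately show ?thesis using seqs_initial by blast
  qed (use assms(1) in \<open>simp add: seq_sum_def\<close>)
  then show ?thesis by (auto simp: fun_eq_iff)
qed

text \<open>Nonemptiness matters: the \<open>Lcm\<close> of the empty set is 1, which need not lie
  in \<open>S\<close>.\<close>

lemma Lcm_mem:
  assumes "finite K" "K \<noteq> {}" "K \<subseteq> S" "\<And>\<alpha> \<beta> :: nat. \<alpha> \<in> S \<Longrightarrow> \<beta> \<in> S \<Longrightarrow> lcm \<alpha> \<beta> \<in> S"
  shows "Lcm K \<in> S"
  using assms(1-3)
proof (induction K rule: finite_ne_induct)
  case (singleton k)
  then show ?case by simp
next
  case (insert k K)
  then show ?case using assms(4) by simp
qed

text \<open>Chains contribute the value 0. Removing the point \<open>a0\<close>, and not the value
  1, keeps 1 in the set exactly when there is a second fixed point.\<close>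

definition nonzero_periods :: "('a \<Rightarrow> 'a) \<Rightarrow> 'a set \<Rightarrow> 'a \<Rightarrow> nat set" where
  "nonzero_periods f A a0 = {t. \<exists>a\<in>A. a \<noteq> a0 \<and> has_period f a t}"

lemma nonzero_periodsI: "a \<in> A \<Longrightarrow> a \<noteq> a0 \<Longrightarrow> has_period f a t \<Longrightarrow> t \<in> nonzero_periods f A a0"
  by (auto simp: nonzero_periods_def)

lemma nonzero_periodsE:
  assumes "t \<in> nonzero_periods f A a0"
  obtains a where "a \<in> A" "a \<noteq> a0" "has_period f a t"
  using assms by (auto simp: nonzero_periods_def)

lemma seq_sum_periods:
  assumes fin: "finite S" and lcm: "\<And>\<alpha> \<beta>. \<alpha> \<in> S \<Longrightarrow> \<beta> \<in> S \<Longrightarrow> lcm \<alpha> \<beta> \<in> S"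
  shows "nonzero_periods seq_shift (seq_sum S) 0 = S"
proof (intro equalityI subsetI)
  fix t assume "t \<in> nonzero_periods seq_shift (seq_sum S) 0"
  then obtain v where v: "v \<in> seq_sum S" "v \<noteq> 0" "has_period seq_shift v t"
    by (rule nonzero_periodsE)
  let ?K = "{k. \<exists>i. v (k, i) \<noteq> 0}"
  have t: "t = Lcm ?K" using has_period_unique[OF v(3) seq_shift_period[OF v(1)]] .
  have "?K \<subseteq> S" using v(1) by (auto simp: seq_sum_def)
  moreover have "?K \<noteq> {}" using v(2) by (auto simp: fun_eq_iff)
  ultimately show "t \<in> S" using Lcm_mem[OF finite_subset[OF _ fin]] lcm t by blast
next
  fix k assume k: "k \<in> S"
  obtain x j where x: "x \<in> seqs k" "x j \<noteq> 0" using seqs_nonzero by blast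
  define v where "v = (\<lambda>(l, i). if l = k then x i else 0)"
  have v: "v \<in> seq_sum S" unfolding v_def by (rule seq_sum_single[OF k x(1)])
  have vj: "v (k, j) \<noteq> 0" using x(2) by (simp add: v_def)
  then have "{l. \<exists>i. v (l, i) \<noteq> 0} = {k}" by (auto simp: v_def split: if_splits)
  then have "has_period seq_shift v k" using seq_shift_period[OF v] by simp
  moreover have "v \<noteq> 0" using vj by (metis zero_fun_apply)
  ultimately show "k \<in> nonzero_periods seq_shift (seq_sum S) 0"
    using v by (intro nonzero_periodsI)
qed

section \<open>The characterization\<close>

lemma funpow_fixed_point: "f a = a \<Longrightarrow> (f ^^ m) a = a"
  by (induction m) simp_all

lemma fixed_point_period:
  assumes "f a = a" shows "has_period f a 1"
  using assms by (simp add: has_period_def funpow_fixed_point)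

lemma fixed_point_orbit:
  assumes bij: "bij_betw f A A" and a0: "a0 \<in> A" "f a0 = a0" and a: "a \<in> A"
  shows "orbit f A a = {a0} \<longleftrightarrow> a = a0"
proof
  assume "orbit f A a = {a0}"
  then show "a = a0" using orbit_self[OF a, of f] by blast
next
  assume "a = a0"
  have fixed: "(f ^^ m) a0 = a0" for m using a0(2) by (rule funpow_fixed_point)
  have "b = a0" if "b \<in> A" "(f ^^ n) b = a0" for b n
    using funpow_inj[OF bij that(1) a0(1)] that(2) fixed by metis
  then show "orbit f A a = {a0}" unfolding orbit_def \<open>a = a0\<close> fixed using a0(1) fixed by auto
qed

text \<open>Apart from the nonzero periods only the zero cycle is left, so maps with the same
  nonzero periods agree there too.\<close>

lemma orbits_other_periods:
  assumes bij: "bij_betw f A A" and a0: "a0 \<in> A" "f a0 = a0" and t: "t \<notin> nonzero_periods f A a0"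
  shows "orbits f A t = (if t = 1 then {{a0}} else {})"
proof -
  have "{a \<in> A. has_period f a t} = (if t = 1 then {a0} else {})"
  proof (cases "t = 1")
    case True
    then show ?thesis
      using t a0(1) fixed_point_period[of f a0, OF a0(2)] unfolding nonzero_periods_def by auto
  next
    case False
    then have "\<not> has_period f a0 t" using has_period_unique fixed_point_period[of f a0, OF a0(2)] by metis
    then show ?thesis using t False unfolding nonzero_periods_def by auto
  qed
  then show ?thesis using fixed_point_orbit[OF bij a0 a0(1)] by (simp add: orbits_def)
qed

lemma countable_infinite_bij:
  assumes "countable A" "infinite A" "countable B" "infinite B"
  shows "\<exists>\<sigma>. bij_betw \<sigma> A B"
  using bij_betw_trans[OF to_nat_on_infinite[OF assms(1,2)] bij_betw_from_nat_into[OF assms(3,4)]] by blast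

text \<open>For each period the two sets of orbits are either both countably infinite, both a single
  zero cycle, or both empty.\<close>

lemma conjugate_same_periods:
  assumes f: "bij_betw f A A" "countable A" "a0 \<in> A" "f a0 = a0"
    and g: "bij_betw g B B" "countable B" "b0 \<in> B" "g b0 = b0"
    and eq: "nonzero_periods f A a0 = nonzero_periods g B b0"
    and inf: "\<And>t. t \<in> nonzero_periods f A a0 \<Longrightarrow> infinite (orbits f A t) \<and> infinite (orbits g B t)"
  shows "\<exists>h. bij_betw h A B \<and> (\<forall>a\<in>A. h (f a) = g (h a))"
proof (rule conjugation_exists[OF f(1) g(1)])
  fix t
  show "\<exists>\<sigma>. bij_betw \<sigma> (orbits f A t) (orbits g B t)"
  proof (cases "t \<in> nonzero_periods f A a0")
    case True
    have "countable (orbits f A t)" "countable (orbits g B t)"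
      using f(2) g(2) unfolding orbits_def by (auto intro: countable_subset)
    then show ?thesis using inf[OF True] countable_infinite_bij by blast
  next
    case False
    have "bij_betw (\<lambda>_. {b0}) (orbits f A t) (orbits g B t)"
      using orbits_other_periods[OF f(1,3,4) False] orbits_other_periods[OF g(1,3,4), of t] False eq
      by (simp add: bij_betw_def)
    then show ?thesis by blast
  qed
qed blast

text \<open>Two conventions are reconciled: \<open>S\<close> also records chains, as the value 0,
  and \<open>{a0}\<close> counts as a cycle of length 1 in the finiteness condition and in the
  conclusion of the lcm condition.\<close>

lemma cycle_conditions_iff:
  assumes bij: "bij_betw f A A" and a0: "a0 \<in> A" "f a0 = a0"
  defines "S \<equiv> nonzero_periods f A a0"
  shows "finite {m. cycles_of_len f A m \<noteq> {}} \<and>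
      (\<forall>k. cycles_of_len f A k - {{a0}} \<noteq> {} \<longrightarrow> infinite (cycles_of_len f A k)) \<and>
      (chains_of f A \<noteq> {} \<longrightarrow> infinite (chains_of f A)) \<and>
      (\<forall>\<alpha> \<beta>. cycles_of_len f A \<alpha> - {{a0}} \<noteq> {} \<and> cycles_of_len f A \<beta> - {{a0}} \<noteq> {}
          \<longrightarrow> cycles_of_len f A (lcm \<alpha> \<beta>) \<noteq> {})
    \<longleftrightarrow> finite S \<and> (\<forall>k\<in>S. infinite (orbits f A k)) \<and> (\<forall>\<alpha>\<in>S. \<forall>\<beta>\<in>S. lcm \<alpha> \<beta> \<in> S)"
    (is "?L \<longleftrightarrow> ?R")
proof -
  have cyc: "cycles_of_len f A k = (if k = 0 then {} else orbits f A k)" for k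
    by (simp add: cycles_of_len_0 cycles_of_len_eq_orbits[OF bij])
  have nz: "orbits f A k - {{a0}} \<noteq> {} \<longleftrightarrow> k \<in> S" for k
  proof -
    have "orbits f A k - {{a0}} \<noteq> {} \<longleftrightarrow> (\<exists>a\<in>A. has_period f a k \<and> orbit f A a \<noteq> {a0})"
      by (auto simp: orbits_def)
    also have "\<dots> \<longleftrightarrow> k \<in> S"
      unfolding S_def nonzero_periods_def mem_Collect_eq by (metis fixed_point_orbit[OF bij a0])
    finally show ?thesis .
  qed
  have ne: "orbits f A k \<noteq> {} \<longleftrightarrow> k \<in> insert 1 S" for k
    using nz[of k] orbits_other_periods[OF bij a0, of k] unfolding S_def by (auto split: if_splits)
  have cycnz: "cycles_of_len f A k - {{a0}} \<noteq> {} \<longleftrightarrow> k \<noteq> 0 \<and> k \<in> S" for k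
    using nz cyc by simp
  have cycne: "cycles_of_len f A k \<noteq> {} \<longleftrightarrow> k \<noteq> 0 \<and> k \<in> insert 1 S" for k
    using ne[of k] cyc by simp
  have fin: "finite {m. cycles_of_len f A m \<noteq> {}} \<longleftrightarrow> finite S"
  proof
    assume "finite {m. cycles_of_len f A m \<noteq> {}}"
    moreover have "S \<subseteq> insert 0 {m. cycles_of_len f A m \<noteq> {}}" unfolding cycne by auto
    ultimately show "finite S" by (meson finite_insert finite_subset)
  next
    assume "finite S"
    moreover have "{m. cycles_of_len f A m \<noteq> {}} \<subseteq> insert 1 S" unfolding cycne by auto
    ultimately show "finite {m. cycles_of_len f A m \<noteq> {}}" by (meson finite_insert finite_subset)
  qed
  have inf: "(\<forall>k. cycles_of_len f A k - {{a0}} \<noteq> {} \<longrightarrow> infinite (cycles_of_len f A k)) \<and>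
      (chains_of f A \<noteq> {} \<longrightarrow> infinite (chains_of f A)) \<longleftrightarrow> (\<forall>k\<in>S. infinite (orbits f A k))"
  proof -
    have "orbits f A 0 \<noteq> {} \<longleftrightarrow> 0 \<in> S" using ne[of 0] by simp
    moreover have "(\<forall>k. k \<noteq> 0 \<and> k \<in> S \<longrightarrow> infinite (cycles_of_len f A k)) \<longleftrightarrow>
        (\<forall>k\<in>S. k \<noteq> 0 \<longrightarrow> infinite (orbits f A k))"
      by (auto simp: cyc)
    ultimately show ?thesis unfolding cycnz chains_of_eq_orbits[OF bij] by metis
  qed
  \<comment> \<open>Closure is automatic if one length is 0, as the lcm is then 0. The zero cycle
    cannot stand in for a missing cycle either, since an lcm of 1 forces \<alpha> = 1, which is
    already in \<open>S\<close>.\<close>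
  have lcm: "((\<alpha> \<noteq> 0 \<and> \<alpha> \<in> S) \<and> (\<beta> \<noteq> 0 \<and> \<beta> \<in> S) \<longrightarrow> lcm \<alpha> \<beta> \<noteq> 0 \<and> lcm \<alpha> \<beta> \<in> insert 1 S)
      \<longleftrightarrow> (\<alpha> \<in> S \<and> \<beta> \<in> S \<longrightarrow> lcm \<alpha> \<beta> \<in> S)" for \<alpha> \<beta>
  proof (cases "\<alpha> = 0 \<or> \<beta> = 0")
    case True
    then show ?thesis by auto
  next
    case False
    have "\<alpha> = 1" if "lcm \<alpha> \<beta> = 1" using that by (metis dvd_lcm1 nat_dvd_1_iff_1)
    then show ?thesis using False by auto
  qed
  then have "(\<forall>\<alpha> \<beta>. cycles_of_len f A \<alpha> - {{a0}} \<noteq> {} \<and> cycles_of_len f A \<beta> - {{a0}} \<noteq> {}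
      \<longrightarrow> cycles_of_len f A (lcm \<alpha> \<beta>) \<noteq> {}) \<longleftrightarrow> (\<forall>\<alpha>\<in>S. \<forall>\<beta>\<in>S. lcm \<alpha> \<beta> \<in> S)"
    unfolding cycnz cycne by blast
  then show ?thesis using fin inf by argo
qed

lemma countable_finite_support: "countable {x :: nat \<Rightarrow> int. \<forall>i\<ge>r. x i = 0}"
proof (rule countable_subset)
  show "{x :: nat \<Rightarrow> int. \<forall>i\<ge>r. x i = 0} \<subseteq> range (\<lambda>xs i. if i < length xs then xs ! i else 0)"
  proof
    fix x :: "nat \<Rightarrow> int" assume "x \<in> {x. \<forall>i\<ge>r. x i = 0}"
    then have "x = (\<lambda>i. if i < length (map x [0..<r]) then map x [0..<r] ! i else 0)"
      by (auto simp: fun_eq_iff)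
    then show "x \<in> range (\<lambda>xs i. if i < length xs then xs ! i else 0)" by (rule range_eqI)
  qed
qed simp

section \<open>Necessity of the conditions\<close>

lemma automorphism_imp_conditions:
  assumes f_bij: "bij_betw f A A" and group: "group G" and A: "carrier G = A" and iso: "\<psi> \<in> iso G (Zn_group n)" and f: "f \<in> iso G G"
  obtains a0 where "a0 \<in> A" "f a0 = a0" "finite (nonzero_periods f A a0)"
    "\<forall>k\<in>nonzero_periods f A a0. infinite (orbits f A k)"
    "\<forall>\<alpha>\<in>nonzero_periods f A a0. \<forall>\<beta>\<in>nonzero_periods f A a0. lcm \<alpha> \<beta> \<in> nonzero_periods f A a0"
proof -
  let ?Z = "{x :: nat \<Rightarrow> int. \<forall>i\<ge>n. x i = 0}"
  have \<psi>: "bij_betw \<psi> A ?Z" using iso A by (simp add: iso_def Zn_group_def)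
  have \<psi>_mult: "\<psi> (a \<otimes>\<^bsub>G\<^esub> b) = \<psi> a + \<psi> b" if "a \<in> A" "b \<in> A" for a b
    using iso A that by (auto simp: iso_def hom_def Zn_group_def plus_fun_def)
  have f_mult: "f (a \<otimes>\<^bsub>G\<^esub> b) = f a \<otimes>\<^bsub>G\<^esub> f b" if "a \<in> A" "b \<in> A" for a b
    using f A that by (auto simp: iso_def hom_def)
  have mult_A: "a \<otimes>\<^bsub>G\<^esub> b \<in> A" if "a \<in> A" "b \<in> A" for a b
    using monoid.m_closed[OF group.is_monoid[OF group]] A that by blast
  define \<psi>' where "\<psi>' = inv_into A \<psi>"
  have \<psi>': "bij_betw \<psi>' ?Z A" unfolding \<psi>'_def by (rule bij_betw_inv_into[OF \<psi>])
  have inv: "\<psi> (\<psi>' x) = x" if "x \<in> ?Z" for x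
    unfolding \<psi>'_def using \<psi> that by (rule bij_betw_inv_into_right)
  have inv': "\<psi>' (\<psi> a) = a" if "a \<in> A" for a
    unfolding \<psi>'_def using \<psi> that by (rule bij_betw_inv_into_left)
  \<comment> \<open>This is \<open>f\<close> transported to the additive group of integer
    vectors.\<close>
  define g where "g = \<psi> \<circ> (f \<circ> \<psi>')"
  have conj: "\<forall>a\<in>A. \<psi> (f a) = g (\<psi> a)" using inv' by (simp add: g_def)
  have gbij: "bij_betw g ?Z ?Z"
    unfolding g_def by (rule bij_betw_trans[OF bij_betw_trans[OF \<psi>' f_bij] \<psi>])
  interpret int_automorphism ?Z g
  proof
    show "0 \<in> ?Z" "\<And>u v. u \<in> ?Z \<Longrightarrow> v \<in> ?Z \<Longrightarrow> u - v \<in> ?Z" by auto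
    show "bij_betw g ?Z ?Z" by (rule gbij)
    fix u v assume uv: "u \<in> ?Z" "v \<in> ?Z"
    let ?a = "\<psi>' u" and ?b = "\<psi>' v"
    have ab: "?a \<in> A" "?b \<in> A" using \<psi>' uv by (auto dest: bij_betwE)
    have "\<psi>' (u + v) = ?a \<otimes>\<^bsub>G\<^esub> ?b"
      using inv'[OF mult_A[OF ab]] \<psi>_mult[OF ab] inv uv by simp
    moreover have "f ?a \<in> A" "f ?b \<in> A" using ab f_bij by (auto dest: bij_betwE)
    ultimately show "g (u + v) = g u + g v" using f_mult[OF ab] \<psi>_mult by (simp add: g_def)
  qed
  \<comment> \<open>The fixed point sought is the identity element of \<open>G\<close>.\<close>
  define a0 where "a0 = \<psi>' 0"
  have a0: "a0 \<in> A" "\<psi> a0 = 0" using \<psi>' inv zero_mem by (auto simp: a0_def dest: bij_betwE)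
  have "\<psi> (f a0) = \<psi> a0" using conj a0 g_zero by simp
  moreover have "f a0 \<in> A" using f_bij a0(1) by (simp add: bij_betwE)
  ultimately have fa0: "f a0 = a0" using inv' a0(1) by metis
  have nz: "\<psi> a \<in> ?Z \<and> \<psi> a \<noteq> 0 \<and> has_period g (\<psi> a) t" if "a \<in> A" "a \<noteq> a0" "has_period f a t" for a t
  proof (intro conjI)
    show "\<psi> a \<in> ?Z" using bij_betwE[OF \<psi>] that(1) by (rule bspec)
    show "\<psi> a \<noteq> 0" using inv'[OF that(1)] inv'[OF a0(1)] a0(2) that(2) by metis
    show "has_period g (\<psi> a) t" using conjugate_has_period[OF f_bij \<psi> conj that(1)] that(3) by blast
  qed
  have periods: "nonzero_periods f A a0 = nonzero_periods g ?Z 0"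
  proof (intro equalityI subsetI)
    fix t assume "t \<in> nonzero_periods f A a0"
    then obtain a where "a \<in> A" "a \<noteq> a0" "has_period f a t" by (rule nonzero_periodsE)
    then show "t \<in> nonzero_periods g ?Z 0" using nz by (intro nonzero_periodsI[of "\<psi> a"]) simp_all
  next
    fix t assume "t \<in> nonzero_periods g ?Z 0"
    then obtain v where v: "v \<in> ?Z" "v \<noteq> 0" "has_period g v t" by (rule nonzero_periodsE)
    have "\<psi>' v \<in> A" "\<psi>' v \<noteq> a0" using v \<psi>' inv a0(2) by (auto dest: bij_betwE)
    moreover have "has_period f (\<psi>' v) t"
      using conjugate_has_period[OF f_bij \<psi> conj \<open>\<psi>' v \<in> A\<close>] inv v by simp
    ultimately show "t \<in> nonzero_periods f A a0" by (rule nonzero_periodsI)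
  qed
  show ?thesis
  proof (rule that[OF a0(1) fa0])
    have "v = 0" if "v \<in> ?Z" "\<forall>i\<in>{..<n}. v i = 0" for v
    proof
      fix i show "v i = 0 i" using that by (cases "i < n") simp_all
    qed
    from common_period[OF finite_lessThan this]
    obtain N where N: "N > 0" "\<forall>v\<in>?Z. \<forall>t>0. has_period g v t \<longrightarrow> t dvd N" by blast
    have "nonzero_periods g ?Z 0 \<subseteq> insert 0 {t. t dvd N}"
      using N(2) by (auto elim!: nonzero_periodsE)
    moreover have "finite (insert 0 {t. t dvd N})" using N(1) by simp
    ultimately show "finite (nonzero_periods f A a0)" unfolding periods by (rule finite_subset)
    show "\<forall>k\<in>nonzero_periods f A a0. infinite (orbits f A k)"
    proof
      fix k assume "k \<in> nonzero_periods f A a0"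
      then obtain v where "v \<in> ?Z" "v \<noteq> 0" "has_period g v k"
        unfolding periods by (rule nonzero_periodsE)
      then have "infinite (orbits g ?Z k)" by (rule infinite_orbits)
      then show "infinite (orbits f A k)"
        unfolding conjugate_orbits[OF f_bij gbij \<psi> conj] by (rule contrapos_nn) (rule finite_imageI)
    qed
    show "\<forall>\<alpha>\<in>nonzero_periods f A a0. \<forall>\<beta>\<in>nonzero_periods f A a0. lcm \<alpha> \<beta> \<in> nonzero_periods f A a0"
    proof (intro ballI)
      fix \<alpha> \<beta> assume ab: "\<alpha> \<in> nonzero_periods f A a0" "\<beta> \<in> nonzero_periods f A a0"
      obtain u where u: "u \<in> ?Z" "u \<noteq> 0" "has_period g u \<alpha>"
        using ab(1) unfolding periods by (rule nonzero_periodsE)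
      obtain v where v: "v \<in> ?Z" "v \<noteq> 0" "has_period g v \<beta>"
        using ab(2) unfolding periods by (rule nonzero_periodsE)
      show "lcm \<alpha> \<beta> \<in> nonzero_periods f A a0"
      \<comment> \<open>\<open>period_lcm\<close> needs positive periods, and for lcm 1 the vector
        it yields might be zero. In these cases the lcm is \<alpha> or \<beta>, so a vector is
        already at hand.\<close>
      proof (cases "\<alpha> = 0 \<or> \<beta> = 0 \<or> lcm \<alpha> \<beta> = 1")
        case True
        moreover have "\<alpha> = 1" if "lcm \<alpha> \<beta> = 1" using that by (metis dvd_lcm1 nat_dvd_1_iff_1)
        ultimately have "lcm \<alpha> \<beta> = \<alpha> \<or> lcm \<alpha> \<beta> = \<beta>" by auto
        then show ?thesis using ab by (elim disjE) simp_all
      next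
        case False
        then obtain w where w: "w \<in> ?Z" "has_period g w (lcm \<alpha> \<beta>)"
          using period_lcm[OF u(1,3) v(1,3)] by blast
        have "w \<noteq> 0"
          using False w(2) fixed_point_period[of g 0, OF g_zero] has_period_unique by metis
        with w(1) show ?thesis unfolding periods using w(2) by (rule nonzero_periodsI)
      qed
    qed
  qed
qed

section \<open>Sufficiency of the conditions\<close>

lemma conditions_imp_automorphism:
  assumes f_bij: "bij_betw f A A" and A: "countable A" "infinite A" and a0: "a0 \<in> A" "f a0 = a0"
  defines "S \<equiv> nonzero_periods f A a0"
  assumes fin: "finite S" and inf: "\<forall>k\<in>S. infinite (orbits f A k)"
    and lcm: "\<forall>\<alpha>\<in>S. \<forall>\<beta>\<in>S. lcm \<alpha> \<beta> \<in> S"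
  shows "\<exists>n\<ge>1. \<exists>G :: 'a monoid. carrier G = A \<and> group G \<and> G \<cong> Zn_group n \<and> f \<in> iso G G"
proof -
  let ?H = "seq_sum S"
  interpret int_automorphism ?H seq_shift by (rule seq_shift_automorphism)
  have periods: "nonzero_periods seq_shift ?H 0 = S" using seq_sum_periods[OF fin] lcm by blast
  have "finite (SIGMA k:S. {..<k + 2})" using fin by simp
  from int_subgroup_free[OF this int_subgroup_axioms seq_sum_coordinates[of _ S]]
  obtain r \<phi> where \<phi>: "bij_betw \<phi> {x :: nat \<Rightarrow> int. \<forall>i\<ge>r. x i = 0} ?H"
    and \<phi>_add: "\<And>x y. \<forall>i\<ge>r. x i = 0 \<Longrightarrow> \<forall>i\<ge>r. y i = 0 \<Longrightarrow> \<phi> (x + y) = \<phi> x + \<phi> y"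
    by blast
  let ?Z = "{x :: nat \<Rightarrow> int. \<forall>i\<ge>r. x i = 0}"
  have countable: "countable ?H"
    using countable_image[OF countable_finite_support[of r], of \<phi>] \<phi> by (simp add: bij_betw_def)
  have "infinite (orbits seq_shift ?H k)" if k: "k \<in> S" for k
  proof -
    have "k \<in> nonzero_periods seq_shift ?H 0" using k by (simp only: periods)
    then obtain v where "v \<in> ?H" "v \<noteq> 0" "has_period seq_shift v k" by (rule nonzero_periodsE)
    then show ?thesis by (rule infinite_orbits)
  qed
  then have infinite: "infinite (orbits f A t) \<and> infinite (orbits seq_shift ?H t)"
    if "t \<in> nonzero_periods f A a0" for t
    using inf that unfolding S_def[symmetric] by blast
  have eq: "nonzero_periods f A a0 = nonzero_periods seq_shift ?H 0"
    by (simp only: periods S_def[symmetric])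
  obtain h where h: "bij_betw h A ?H" and hf: "\<And>a. a \<in> A \<Longrightarrow> h (f a) = seq_shift (h a)"
    using conjugate_same_periods[OF f_bij A(1) a0 bij countable zero_mem g_zero eq infinite] by blast
  define h' where "h' = inv_into A h"
  have h': "h' v \<in> A \<and> h (h' v) = v" if "v \<in> ?H" for v
    unfolding h'_def using bij_betw_inv_into[OF h] bij_betw_inv_into_right[OF h] that by (simp add: bij_betwE)
  have h'h: "h' (h a) = a" if "a \<in> A" for a
    unfolding h'_def using bij_betw_inv_into_left[OF h] that by simp
  have hH: "h a \<in> ?H" if "a \<in> A" for a using h that by (simp add: bij_betwE)
  \<comment> \<open>Addition is pulled back along the conjugation \<open>h\<close>, which makes
    \<open>f\<close> additive because the shift is. The identity is the fixed point
    \<open>h' 0\<close>, possibly different from \<open>a0\<close>: \<open>h\<close> may send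
    \<open>a0\<close> to a nonzero fixed vector.\<close>
  define G :: "'a monoid" where "G = \<lparr>carrier = A, monoid.mult = \<lambda>a b. h' (h a + h b), one = h' 0\<rparr>"
  have car: "carrier G = A" by (simp add: G_def)
  have mult: "a \<otimes>\<^bsub>G\<^esub> b \<in> A" "h (a \<otimes>\<^bsub>G\<^esub> b) = h a + h b" if "a \<in> A" "b \<in> A" for a b
    using h'[OF add_mem[OF hH hH]] that by (simp_all add: G_def)
  have one: "\<one>\<^bsub>G\<^esub> \<in> A" "h \<one>\<^bsub>G\<^esub> = 0" using h'[OF zero_mem] by (simp_all add: G_def)
  have h_inj: "a = b" if "a \<in> A" "b \<in> A" "h a = h b" for a b using h'h that by metis
  have "group G"
  proof (rule groupI, unfold car)
    show "x \<otimes>\<^bsub>G\<^esub> y \<otimes>\<^bsub>G\<^esub> z = x \<otimes>\<^bsub>G\<^esub> (y \<otimes>\<^bsub>G\<^esub> z)" if "x \<in> A" "y \<in> A" "z \<in> A" for x y z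
      by (rule h_inj) (use that mult in \<open>simp_all only: add.assoc\<close>)
    show "\<one>\<^bsub>G\<^esub> \<otimes>\<^bsub>G\<^esub> x = x" if "x \<in> A" for x
      by (rule h_inj) (use that mult one in \<open>simp_all only: add_0_left\<close>)
    show "\<exists>y\<in>A. y \<otimes>\<^bsub>G\<^esub> x = \<one>\<^bsub>G\<^esub>" if x: "x \<in> A" for x
    proof (rule bexI)
      show y: "h' (- h x) \<in> A" using h' uminus_mem hH x by blast
      show "h' (- h x) \<otimes>\<^bsub>G\<^esub> x = \<one>\<^bsub>G\<^esub>"
      proof (rule h_inj)
        have "h (h' (- h x)) = - h x" using h' uminus_mem hH x by blast
        then show "h (h' (- h x) \<otimes>\<^bsub>G\<^esub> x) = h \<one>\<^bsub>G\<^esub>"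
          using mult(2)[OF y x] one(2) by (simp only: left_minus)
      qed (use mult y x one in auto)
    qed
  qed (use mult one in auto)
  moreover have "G \<cong> Zn_group r"
  proof -
    define \<psi> where "\<psi> = inv_into ?Z \<phi> \<circ> h"
    have bij\<psi>: "bij_betw \<psi> A ?Z"
      unfolding \<psi>_def by (rule bij_betw_trans[OF h bij_betw_inv_into[OF \<phi>]])
    have Z: "\<psi> a \<in> ?Z" "\<phi> (\<psi> a) = h a" if "a \<in> A" for a
      using bij\<psi> that bij_betw_inv_into_right[OF \<phi> hH[OF that]] by (auto simp: \<psi>_def dest: bij_betwE)
    have "\<psi> (a \<otimes>\<^bsub>G\<^esub> b) = \<psi> a + \<psi> b" if ab: "a \<in> A" "b \<in> A" for a b
    proof -
      have eq: "\<phi> (\<psi> a + \<psi> b) = \<phi> (\<psi> (a \<otimes>\<^bsub>G\<^esub> b))"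
        using \<phi>_add Z mult ab by simp
      have sum: "\<psi> a + \<psi> b \<in> ?Z" using Z(1)[OF ab(1)] Z(1)[OF ab(2)] by simp
      have "\<psi> (a \<otimes>\<^bsub>G\<^esub> b) \<in> ?Z" using Z(1) mult(1) ab by blast
      then show ?thesis by (rule inj_onD[OF bij_betw_imp_inj_on[OF \<phi>] eq sum, symmetric])
    qed
    then have "\<psi> \<in> iso G (Zn_group r)"
      using bij\<psi> by (auto simp: iso_def hom_def car Zn_group_def plus_fun_def dest: bij_betwE)
    then show ?thesis by (rule is_isoI)
  qed
  moreover have "f \<in> iso G G"
  proof -
    have fA: "f a \<in> A" if "a \<in> A" for a using f_bij that by (simp add: bij_betwE)
    have "f (a \<otimes>\<^bsub>G\<^esub> b) = f a \<otimes>\<^bsub>G\<^esub> f b" if "a \<in> A" "b \<in> A" for a b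
      by (rule h_inj) (use that mult fA hf g_add hH in \<open>simp_all\<close>)
    then show ?thesis using f_bij fA by (simp add: iso_def hom_def car)
  qed
  \<comment> \<open>Rank 0 would leave a single point, whereas \<open>A\<close> is infinite.\<close>
  moreover have "r \<ge> 1"
  proof (rule ccontr)
    assume "\<not> r \<ge> 1"
    then have "?Z \<subseteq> {0}" by (auto simp: fun_eq_iff)
    then have "finite ?Z" by (rule finite_subset) simp
    then have "finite A" using bij_betw_finite[OF \<phi>] bij_betw_finite[OF h] by blast
    then show False using A(2) by blast
  qed
  ultimately show ?thesis using car by blast
qed

theorem theorem3p9:
  fixes A :: "'a set" and f :: "'a \<Rightarrow> 'a"
  assumes "countable A" and "infinite A" and "bij_betw f A A"
  shows "(\<exists>n::nat. n \<ge> 1 \<and> (\<exists>G :: 'a monoid. carrier G = A \<and> group G \<and> G \<cong> Zn_group n \<and> f \<in> iso G G))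
    \<longleftrightarrow> (\<exists>a0\<in>A. f a0 = a0 \<and>
          finite {m. cycles_of_len f A m \<noteq> {}} \<and>
          (\<forall>k. cycles_of_len f A k - {{a0}} \<noteq> {} \<longrightarrow> infinite (cycles_of_len f A k)) \<and>
          (chains_of f A \<noteq> {} \<longrightarrow> infinite (chains_of f A)) \<and>
          (\<forall>\<alpha> \<beta>. cycles_of_len f A \<alpha> - {{a0}} \<noteq> {} \<and> cycles_of_len f A \<beta> - {{a0}} \<noteq> {}
              \<longrightarrow> cycles_of_len f A (lcm \<alpha> \<beta>) \<noteq> {}))"
proof (standard, goal_cases)
  case 1
  then obtain n and G :: "'a monoid" where G: "carrier G = A" "group G" "f \<in> iso G G"
    and "G \<cong> Zn_group n" by blast
  then obtain \<psi> where "\<psi> \<in> iso G (Zn_group n)" unfolding is_iso_def by blast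
  from automorphism_imp_conditions[OF assms(3) G(2,1) this G(3)]
  obtain a0 where a0: "a0 \<in> A" "f a0 = a0" and conditions: "finite (nonzero_periods f A a0)"
    "\<forall>k\<in>nonzero_periods f A a0. infinite (orbits f A k)"
    "\<forall>\<alpha>\<in>nonzero_periods f A a0. \<forall>\<beta>\<in>nonzero_periods f A a0. lcm \<alpha> \<beta> \<in> nonzero_periods f A a0"
    by blast
  then show ?case
    using cycle_conditions_iff[OF assms(3) a0, THEN iffD2, OF conjI[OF conditions(1) conjI[OF conditions(2,3)]]]
    by (intro bexI[of _ a0] conjI[OF a0(2)])
next
  case 2
  then obtain a0 where a0: "a0 \<in> A" "f a0 = a0" and conditions: "finite {m. cycles_of_len f A m \<noteq> {}} \<and>
      (\<forall>k. cycles_of_len f A k - {{a0}} \<noteq> {} \<longrightarrow> infinite (cycles_of_len f A k)) \<and>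
      (chains_of f A \<noteq> {} \<longrightarrow> infinite (chains_of f A)) \<and>
      (\<forall>\<alpha> \<beta>. cycles_of_len f A \<alpha> - {{a0}} \<noteq> {} \<and> cycles_of_len f A \<beta> - {{a0}} \<noteq> {}
          \<longrightarrow> cycles_of_len f A (lcm \<alpha> \<beta>) \<noteq> {})"
    by (elim bexE conjE) (rule that, assumption+, intro conjI)
  note c = cycle_conditions_iff[OF assms(3) a0, THEN iffD1, OF conditions]
  show ?case
    using conditions_imp_automorphism[OF assms(3,1,2) a0 c[THEN conjunct1] c[THEN conjunct2, THEN conjunct1]
        c[THEN conjunct2, THEN conjunct2]] by blast
qed

end
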